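(* Suppose $n\ge 2$. If $\delta>\frac n2$, then the bilinear Bochner-Riesz operator $S^{\delta}$ is bounded from $L^{1}(\mathbb{R}^n)\times L^{\infty}(\mathbb{R}^n)$ into $L^1(\mathbb{R}^n)$. Moreover, for some constant $C=C_\delta$ we have $$\|S^{\delta}\|_{L^{1}\times L^{\infty}\to L^{1}}\le C .$$
   Context: The Fourier transform on $\mathbb{R}^n$ is $\widehat f(\xi)=\int_{\mathbb{R}^n}e^{-2\pi i x\cdot\xi}f(x)\,dx$. For $\delta\ge 0$ and Schwartz functions $f,g$ on $\mathbb{R}^n$, the bilinear Bochner-Riesz operator is $$S^{\delta}(f,g)(x)=\iint_{|\xi|^2+|\eta|^2\le 1}(1-|\xi|^2-|\eta|^2)^{\delta}\,\widehat f(\xi)\,\widehat g(\eta)\,e^{2\pi i x\cdot(\xi+\eta)}\,d\xi\,d\eta .$$ "Bounded from $L^{p_1}\times L^{p_2}$ to $L^p$" means that there is a constant $C$ with $\|S^\delta(f,g)\|_p\le C\|f\|_{p_1}\|g\|_{p_2}$ for all Schwartz $f,g$; the least such $C$ is the operator norm $\|S^\delta\|_{L^{p_1}\times L^{p_2}\to L^p}$. *)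

theory Defs
  imports "HOL-Probability.Essential_Supremum"
begin

text \<open>Iterated partial derivatives: the list of directions \<open>[b\<^sub>1, \<dots>, b\<^sub>k]\<close> of
  standard basis vectors plays the role of a multi-index, giving
  \<open>\<partial>\<^bsub>b\<^sub>1\<^esub> \<dots> \<partial>\<^bsub>b\<^sub>k\<^esub> f\<close>.\<close>

fun iterated_partial ::
  "'a::euclidean_space list \<Rightarrow> ('a \<Rightarrow> complex) \<Rightarrow> 'a \<Rightarrow> complex" where
  "iterated_partial [] f = f"
| "iterated_partial (b # bs) f =
     (\<lambda>x. frechet_derivative (iterated_partial bs f) (at x) b)"

text \<open>Since \<^const>\<open>frechet_derivative\<close> is unspecified where the derivative does not exist,
  differentiability is required at every order; together these requirements
  say that \<open>f\<close> is smooth.\<close>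

definition schwartz :: "('a::euclidean_space \<Rightarrow> complex) \<Rightarrow> bool" where
  "schwartz f \<longleftrightarrow>
     (\<forall>bs. set bs \<subseteq> Basis \<longrightarrow>
        (\<forall>x. iterated_partial bs f differentiable (at x)) \<and>
        (\<forall>k. \<exists>B. \<forall>x. norm x ^ k * norm (iterated_partial bs f x) \<le> B))"

definition fourier_transform ::
  "('a::euclidean_space \<Rightarrow> complex) \<Rightarrow> 'a \<Rightarrow> complex" where
  "fourier_transform f \<xi> =
     (LINT x|lborel. exp (- 2 * complex_of_real pi * \<i> * complex_of_real (x \<bullet> \<xi>)) * f x)"

text \<open>The double integral is an integral over a subset of the product space.
  HOL has \<open>0 powr 0 = 0\<close>, so for \<open>\<delta> = 0\<close> the multiplier below
  differs from the indicator function of the closed unit ball only on the unit sphere, a null set.\<close>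

definition bilinear_bochner_riesz ::
  "real \<Rightarrow> ('a::euclidean_space \<Rightarrow> complex) \<Rightarrow> ('a \<Rightarrow> complex) \<Rightarrow> 'a \<Rightarrow> complex" where
  "bilinear_bochner_riesz \<delta> f g x =
     (LINT z:{z. (norm (fst z))\<^sup>2 + (norm (snd z))\<^sup>2 \<le> 1}|lborel.
        complex_of_real ((1 - (norm (fst z))\<^sup>2 - (norm (snd z))\<^sup>2) powr \<delta>)
        * fourier_transform f (fst z) * fourier_transform g (snd z)
        * exp (2 * complex_of_real pi * \<i> * complex_of_real (x \<bullet> (fst z + snd z))))"

text \<open>The (quasi-)norm of \<open>L\<^sup>p\<close> for \<open>0 < p \<le> \<infinity>\<close>, with value \<open>\<infinity>\<close> on measurable
  functions outside \<open>L\<^sup>p\<close>.  It is only meaningful for measurable functions.\<close>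

definition Lp_norm :: "ennreal \<Rightarrow> ('a::euclidean_space \<Rightarrow> complex) \<Rightarrow> ennreal" where
  "Lp_norm p f =
     (if p = \<infinity> then esssup lborel (\<lambda>x. ennreal (norm (f x)))
      else let I = (\<integral>\<^sup>+ x. ennreal (norm (f x) powr enn2real p) \<partial>lborel)
           in if I = \<infinity> then \<infinity> else ennreal (enn2real I powr (1 / enn2real p)))"

text \<open>The measurability requirement together with the norm bound says that \<open>T f g\<close> is a
  member of \<open>L\<^sup>p\<close>.\<close>

definition bilinear_Lp_bound ::
  "(('a::euclidean_space \<Rightarrow> complex) \<Rightarrow> ('a \<Rightarrow> complex) \<Rightarrow> 'a \<Rightarrow> complex)
     \<Rightarrow> ennreal \<Rightarrow> ennreal \<Rightarrow> ennreal \<Rightarrow> ennreal \<Rightarrow> bool" where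
  "bilinear_Lp_bound T p1 p2 p C \<longleftrightarrow>
     (\<forall>f g. schwartz f \<longrightarrow> schwartz g \<longrightarrow>
        T f g \<in> borel_measurable lborel \<and>
        Lp_norm p (T f g) \<le> C * Lp_norm p1 f * Lp_norm p2 g)"

definition bilinear_Lp_bounded ::
  "(('a::euclidean_space \<Rightarrow> complex) \<Rightarrow> ('a \<Rightarrow> complex) \<Rightarrow> 'a \<Rightarrow> complex)
     \<Rightarrow> ennreal \<Rightarrow> ennreal \<Rightarrow> ennreal \<Rightarrow> bool" where
  "bilinear_Lp_bounded T p1 p2 p \<longleftrightarrow>
     (\<exists>C::real. C \<ge> 0 \<and> bilinear_Lp_bound T p1 p2 p (ennreal C))"

text \<open>The operator norm, equal to \<open>\<infinity>\<close> for unbounded operators.\<close>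

definition bilinear_Lp_opnorm ::
  "(('a::euclidean_space \<Rightarrow> complex) \<Rightarrow> ('a \<Rightarrow> complex) \<Rightarrow> 'a \<Rightarrow> complex)
     \<Rightarrow> ennreal \<Rightarrow> ennreal \<Rightarrow> ennreal \<Rightarrow> ennreal" where
  "bilinear_Lp_opnorm T p1 p2 p = Inf {C. bilinear_Lp_bound T p1 p2 p C}"

end

theory Submission
  imports Defs "HOL-Probability.Probability" "HOL-Real_Asymp.Real_Asymp"
begin

text \<open>Fourier inversion for the density \<open>s\<^sup>\<delta> e\<^sup>-\<^sup>s\<close> on the half line, whose transform is
  \<open>\<Gamma>(\<delta> + 1) (1 + it)\<close> to the power \<open>-\<delta> - 1\<close>, writes \<open>max 0 A\<close> to the power \<open>\<delta>\<close> as an absolutely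
  convergent superposition of the exponentials \<open>exp (w A)\<close> with \<open>w = 1 + it\<close>.  Taking
  \<open>A = 1 - |\<xi>|\<^sup>2 - |\<eta>|\<^sup>2\<close> splits the multiplier, so that \<open>S\<^sup>\<delta>(f,g)\<close> is an average over \<open>t\<close> of the products
  \<open>H\<^sub>w f \<cdot> H\<^sub>w g\<close>, where \<open>H\<^sub>w\<close> has the multiplier \<open>exp (-w |\<xi>|\<^sup>2)\<close> and an explicit Gaussian kernel.

  It remains to bound \<open>H\<^sub>w f \<cdot> H\<^sub>w g\<close> in \<open>L\<^sup>1\<close> by \<open>C |w|\<close> to the power \<open>n / 2\<close> times \<open>\<parallel>f\<parallel>\<^sub>1 \<parallel>g\<parallel>\<^sub>\<infinity>\<close>, since
  \<open>|w|\<close> to the power \<open>n / 2 - \<delta> - 1\<close> is integrable in \<open>t\<close> exactly when \<open>\<delta> > n / 2\<close>.  By translation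
  invariance \<open>f\<close> may be a point mass, and by Cauchy-Schwarz against the modulus of the kernel one needs an
  \<open>L\<^sup>2\<close> bound for \<open>H\<^sub>w g\<close> with a Gaussian weight of width \<open>|w|\<close>.  Expanding the square, this follows from
  the absolute integrability of an explicitly computable Gram kernel.\<close>

lemma has_vector_derivative_iff_tendsto:
  fixes f :: "real \<Rightarrow> 'a::real_normed_vector"
  shows "(f has_vector_derivative D) (at t) \<longleftrightarrow> ((\<lambda>s. (f s - f t) /\<^sub>R (s - t)) \<longlongrightarrow> D) (at t)"
proof -
  have "norm (f s - f t - (s - t) *\<^sub>R D) / norm (s - t) = norm ((f s - f t) /\<^sub>R (s - t) - D)"
    if "s \<noteq> t" for s
  proof -
    have "(f s - f t) /\<^sub>R (s - t) - D = (f s - f t - (s - t) *\<^sub>R D) /\<^sub>R (s - t)"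
      using that by (simp add: scaleR_diff_right)
    then show ?thesis
      by (simp add: divide_inverse mult.commute)
  qed
  then have "((\<lambda>s. norm (f s - f t - (s - t) *\<^sub>R D) / norm (s - t)) \<longlongrightarrow> 0) (at t) \<longleftrightarrow>
    ((\<lambda>s. norm ((f s - f t) /\<^sub>R (s - t) - D)) \<longlongrightarrow> 0) (at t)"
    by (intro filterlim_cong refl) (auto simp: eventually_at_filter)
  then show ?thesis
    unfolding has_vector_derivative_def has_derivative_iff_norm
    using LIM_zero_iff[of "\<lambda>s. (f s - f t) /\<^sub>R (s - t)" D "at t"]
    by (simp add: bounded_linear_scaleR_left tendsto_norm_zero_iff)
qed

lemma has_vector_derivative_integral:
  fixes f f' :: "real \<Rightarrow> 'a \<Rightarrow> complex"
  assumes T: "open T" "convex T" "t \<in> T"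
    and f: "\<And>s. s \<in> T \<Longrightarrow> integrable M (f s)"
    and deriv: "\<And>s x. s \<in> T \<Longrightarrow> ((\<lambda>s. f s x) has_vector_derivative f' s x) (at s)"
    and bound: "\<And>s x. s \<in> T \<Longrightarrow> norm (f' s x) \<le> g x"
    and g: "integrable M g"
    and f': "f' t \<in> borel_measurable M"
  shows "((\<lambda>s. \<integral>x. f s x \<partial>M) has_vector_derivative (\<integral>x. f' t x \<partial>M)) (at t)"
proof -
  define q where "q = (\<lambda>s x. (f s x - f t x) /\<^sub>R (s - t))"
  have q_lim: "((\<lambda>s. q s x) \<longlongrightarrow> f' t x) (at t)" for x
    using deriv[OF T(3), of x] unfolding q_def has_vector_derivative_iff_tendsto .
  have q_bound: "norm (q s x) \<le> g x" if s: "s \<in> T" "s \<noteq> t" for s x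
  proof -
    have "norm (f s x - f t x) \<le> g x * norm (s - t)"
    proof (rule differentiable_bound[OF T(2)])
      fix u assume u: "u \<in> T"
      show "((\<lambda>s. f s x) has_derivative (\<lambda>h. h *\<^sub>R f' u x)) (at u within T)"
        using deriv[OF u, of x] by (auto simp: has_vector_derivative_def intro: has_derivative_at_withinI)
      show "onorm (\<lambda>h. h *\<^sub>R f' u x) \<le> g x"
        using bound[OF u, of x]
        by (intro onorm_le) (auto simp: mult.commute[of "g x"] intro!: mult_left_mono)
    qed (use s T in auto)
    then show ?thesis
      using s by (simp add: q_def divide_simps abs_minus_commute)
  qed
  show ?thesis
    unfolding has_vector_derivative_iff_tendsto tendsto_at_iff_sequentially comp_def
  proof (intro allI impI)
    fix S :: "nat \<Rightarrow> real"
    assume S: "\<forall>i. S i \<in> UNIV - {t}" and lim: "S \<longlonglongrightarrow> t"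
    from lim T obtain N where N: "\<And>i. i \<ge> N \<Longrightarrow> S i \<in> T"
      using topological_tendstoD[OF lim T(1,3)] unfolding eventually_sequentially by blast
    have "(\<lambda>i. \<integral>x. q (S (i + N)) x \<partial>M) \<longlonglongrightarrow> (\<integral>x. f' t x \<partial>M)"
    proof (rule integral_dominated_convergence[where w = g])
      show "AE x in M. (\<lambda>i. q (S (i + N)) x) \<longlonglongrightarrow> f' t x"
      proof (intro AE_I2)
        fix x
        have "(\<lambda>i. q (S i) x) \<longlonglongrightarrow> f' t x"
          using q_lim[of x] S lim unfolding tendsto_at_iff_sequentially comp_def by blast
        then show "(\<lambda>i. q (S (i + N)) x) \<longlonglongrightarrow> f' t x"
          by (rule LIMSEQ_ignore_initial_segment)
      qed
      show "AE x in M. norm (q (S (i + N)) x) \<le> g x" for i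
        using q_bound N S by auto
      show "q (S (i + N)) \<in> borel_measurable M" for i
        using f[OF T(3)] f[OF N[of "i + N"]] unfolding q_def by auto
    qed (use g f' in auto)
    moreover have "(\<integral>x. q (S (i + N)) x \<partial>M) =
        ((\<integral>x. f (S (i + N)) x \<partial>M) - (\<integral>x. f t x \<partial>M)) /\<^sub>R (S (i + N) - t)" for i
      using f[OF T(3)] f[OF N[of "i + N"]] unfolding q_def by simp
    ultimately show "(\<lambda>i. ((\<integral>x. f (S i) x \<partial>M) - (\<integral>x. f t x \<partial>M)) /\<^sub>R (S i - t)) \<longlonglongrightarrow> (\<integral>x. f' t x \<partial>M)"
      by (simp only: LIMSEQ_offset[where k = N and f = "\<lambda>i. ((\<integral>x. f (S i) x \<partial>M) - (\<integral>x. f t x \<partial>M)) /\<^sub>R (S i - t)"])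
  qed
qed

lemma integral_deriv_eq_0:
  fixes F F' :: "real \<Rightarrow> complex"
  assumes F: "\<And>x. (F has_vector_derivative F' x) (at x)"
    and c: "\<And>x. isCont F' x"
    and F': "integrable lborel F'"
    and lim: "(F \<longlongrightarrow> 0) at_top" "(F \<longlongrightarrow> 0) at_bot"
  shows "(\<integral>x. F' x \<partial>lborel) = 0"
proof -
  have "(LBINT x=-\<infinity>..\<infinity>. F' x) = 0 - 0"
  proof (rule interval_integral_FTC_integrable)
    show "((F \<circ> real_of_ereal) \<longlongrightarrow> 0) (at_right (-\<infinity>))"
      using lim(2) by (simp add: comp_def at_right_MInf filterlim_filtermap)
    show "((F \<circ> real_of_ereal) \<longlongrightarrow> 0) (at_left \<infinity>)"
      using lim(1) by (simp add: comp_def at_left_PInf filterlim_filtermap)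
  qed (use F c F' in \<open>auto simp: set_integrable_def\<close>)
  then show ?thesis
    by (simp add: interval_lebesgue_integral_def set_lebesgue_integral_def)
qed

lemma integrable_power_gaussian:
  assumes "r > 0"
  shows "integrable lborel (\<lambda>x::real. \<bar>x\<bar> ^ k * exp (- r * x\<^sup>2))"
proof -
  define s where "s = 1 / sqrt (2 * r)"
  have s: "s > 0" "2 * s\<^sup>2 = 1 / r"
    using assms by (auto simp: s_def power_divide)
  have "integrable lborel (\<lambda>x. sqrt (2 * pi * s\<^sup>2) * (normal_density 0 s x * \<bar>x - 0\<bar> ^ k))"
    by (intro integrable_mult_right integrable_normal_moment_abs s)
  also have "(\<lambda>x. sqrt (2 * pi * s\<^sup>2) * (normal_density 0 s x * \<bar>x - 0\<bar> ^ k)) = (\<lambda>x. \<bar>x\<bar> ^ k * exp (- r * x\<^sup>2))"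
    using s assms by (auto simp: normal_density_def fun_eq_iff field_simps)
  finally show ?thesis .
qed

lemma integral_gaussian_real:
  assumes "r > 0"
  shows "(\<integral>x. exp (- r * (x::real)\<^sup>2) \<partial>lborel) = sqrt (pi / r)"
proof -
  define s where "s = 1 / sqrt (2 * r)"
  have s: "s > 0" "2 * s\<^sup>2 = 1 / r" "s\<^sup>2 = 1 / (2 * r)"
    using assms by (auto simp: s_def power_divide)
  have "(\<integral>x. exp (- r * (x::real)\<^sup>2) \<partial>lborel) = (\<integral>x. sqrt (2 * pi * s\<^sup>2) * normal_density 0 s x \<partial>lborel)"
    using s assms by (intro Bochner_Integration.integral_cong) (auto simp: normal_density_def field_simps)
  also have "\<dots> = sqrt (pi / r)"
    using integral_normal_density[OF s(1), of 0] s(3) by simp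
  finally show ?thesis .
qed

lemma
  fixes f :: "'a::euclidean_space \<Rightarrow> real \<Rightarrow> complex"
  assumes f: "\<And>b. b \<in> Basis \<Longrightarrow> integrable lborel (f b)"
  shows integrable_lborel_prod: "integrable lborel (\<lambda>x::'a. \<Prod>b\<in>Basis. f b (x \<bullet> b))"
    and integral_lborel_prod:
      "(\<integral>x. (\<Prod>b\<in>(Basis::'a set). f b (x \<bullet> b)) \<partial>lborel) = (\<Prod>b\<in>Basis. \<integral>t. f b t \<partial>lborel)"
proof -
  interpret product_sigma_finite "\<lambda>b::'a. lborel :: real measure" ..
  have m: "(\<lambda>x::'a. \<Prod>b\<in>Basis. f b (x \<bullet> b)) \<in> borel_measurable borel"
    by (intro borel_measurable_prod measurable_compose[OF _ borel_measurable_integrable[OF f], unfolded measurable_lborel1]) auto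
  have e: "(\<Prod>b\<in>Basis. f b ((\<Sum>c\<in>Basis. x c *\<^sub>R c) \<bullet> b)) = (\<Prod>b\<in>Basis. f b (x b))" for x :: "'a \<Rightarrow> real"
    by (intro prod.cong refl) (simp add: inner_sum_left inner_Basis if_distrib cong: if_cong)
  have g: "(\<lambda>f. \<Sum>b\<in>Basis. f b *\<^sub>R b) \<in> (\<Pi>\<^sub>M b\<in>(Basis::'a set). lborel) \<rightarrow>\<^sub>M borel"
    by measurable
  show "integrable lborel (\<lambda>x::'a. \<Prod>b\<in>Basis. f b (x \<bullet> b))"
    unfolding lborel_eq[where 'a='a]
    by (subst integrable_distr_eq[OF g m]) (auto simp: e intro!: product_integrable_prod f)
  show "(\<integral>x. (\<Prod>b\<in>(Basis::'a set). f b (x \<bullet> b)) \<partial>lborel) = (\<Prod>b\<in>Basis. \<integral>t. f b t \<partial>lborel)"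
    unfolding lborel_eq[where 'a='a]
    by (subst integral_distr[OF g m]) (auto simp: e intro!: product_integral_prod f)
qed

section \<open>Gaussian integrals with complex parameters\<close>

definition cgauss :: "complex \<Rightarrow> complex \<Rightarrow> real \<Rightarrow> complex" where
  "cgauss w b x = exp (- w * (of_real x)\<^sup>2 + b * of_real x)"

lemma norm_cgauss_le:
  assumes "Re w > 0" "norm b \<le> B"
  shows "norm (cgauss w b x) \<le> exp (B\<^sup>2 / (2 * Re w)) * exp (- (Re w / 2) * x\<^sup>2)"
proof -
  have "Re b * x \<le> \<bar>Re b\<bar> * \<bar>x\<bar>"
    by (metis abs_ge_self abs_mult)
  also have "\<dots> \<le> B * \<bar>x\<bar>"
    using assms(2) abs_Re_le_cmod[of b] by (intro mult_right_mono) auto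
  also have "B * \<bar>x\<bar> \<le> Re w / 2 * x\<^sup>2 + B\<^sup>2 / (2 * Re w)"
  proof -
    have "0 \<le> (Re w * \<bar>x\<bar> - B)\<^sup>2 / (2 * Re w)"
      using assms by simp
    also have "\<dots> = Re w / 2 * x\<^sup>2 + B\<^sup>2 / (2 * Re w) - B * \<bar>x\<bar>"
      using assms by (simp add: power2_eq_square field_simps flip: abs_mult)
    finally show ?thesis by simp
  qed
  finally show ?thesis
    by (simp add: cgauss_def flip: exp_add of_real_power)
qed

lemma continuous_on_cgauss [continuous_intros]: "continuous_on A (cgauss w b)"
  unfolding cgauss_def by (intro continuous_intros)

lemma borel_measurable_cgauss [measurable]: "cgauss w b \<in> borel_measurable borel"
  by (intro borel_measurable_continuous_onI continuous_intros)

lemma integrable_power_cgauss: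
  assumes "Re w > 0"
  shows "integrable lborel (\<lambda>x. of_real x ^ k * cgauss w b x)"
proof (rule Bochner_Integration.integrable_bound)
  show "integrable lborel (\<lambda>x. exp ((norm b)\<^sup>2 / (2 * Re w)) * (\<bar>x\<bar> ^ k * exp (- (Re w / 2) * x\<^sup>2)))"
    using assms by (intro integrable_mult_right integrable_power_gaussian) auto
  show "AE x in lborel. norm (of_real x ^ k * cgauss w b x)
      \<le> norm (exp ((norm b)\<^sup>2 / (2 * Re w)) * (\<bar>x\<bar> ^ k * exp (- (Re w / 2) * x\<^sup>2)))"
    using mult_left_mono[OF norm_cgauss_le[OF assms order_refl, of b], of "\<bar>_\<bar> ^ k"]
    by (auto simp: norm_mult norm_power mult_ac)
qed measurable

lemma cgauss_tendsto_0:
  assumes "Re w > 0"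
  shows "((\<lambda>x. of_real x ^ k * cgauss w b x) \<longlongrightarrow> 0) at_top"
    and "((\<lambda>x. of_real x ^ k * cgauss w b x) \<longlongrightarrow> 0) at_bot"
proof -
  define c where "c = exp ((norm b)\<^sup>2 / (2 * Re w))"
  define r where "r = Re w / 2"
  have r: "r > 0" using assms by (simp add: r_def)
  have le: "norm (of_real x ^ k * cgauss w b x) \<le> c * (\<bar>x\<bar> ^ k * exp (- r * x\<^sup>2))" for x
    using mult_left_mono[OF norm_cgauss_le[OF assms order_refl, of b x], of "\<bar>x\<bar> ^ k"]
    by (simp add: norm_mult norm_power mult_ac c_def r_def)
  have "((\<lambda>x. c * (\<bar>x\<bar> ^ k * exp (- r * x\<^sup>2))) \<longlongrightarrow> 0) at_top"
    using r by real_asymp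
  with le show "((\<lambda>x. of_real x ^ k * cgauss w b x) \<longlongrightarrow> 0) at_top"
    by (rule Lim_null_comparison[OF always_eventually, OF allI])
  have "((\<lambda>x. c * (\<bar>x\<bar> ^ k * exp (- r * x\<^sup>2))) \<longlongrightarrow> 0) at_bot"
    using r by real_asymp
  with le show "((\<lambda>x. of_real x ^ k * cgauss w b x) \<longlongrightarrow> 0) at_bot"
    by (rule Lim_null_comparison[OF always_eventually, OF allI])
qed

lemma cgauss_integral_by_parts:
  assumes "Re w > 0"
  shows "2 * w * (\<integral>x. of_real x * cgauss w b x \<partial>lborel) = b * (\<integral>x. cgauss w b x \<partial>lborel)"
    and "2 * w * (\<integral>x. (of_real x)\<^sup>2 * cgauss w 0 x \<partial>lborel) = (\<integral>x. cgauss w 0 x \<partial>lborel)"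
proof -
  note int = integrable_power_cgauss[OF assms, of 0, simplified]
    integrable_power_cgauss[OF assms, of 1, simplified] integrable_power_cgauss[OF assms, of 2]
  note lim = cgauss_tendsto_0[OF assms, of 0, simplified] cgauss_tendsto_0[OF assms, of 1, simplified]
  have "(\<integral>x. b * cgauss w b x - 2 * w * (of_real x * cgauss w b x) \<partial>lborel) = 0"
  proof (rule integral_deriv_eq_0[where F = "cgauss w b"])
    show "(cgauss w b has_vector_derivative b * cgauss w b x - 2 * w * (of_real x * cgauss w b x)) (at x)" for x
      unfolding cgauss_def
      by (rule has_vector_derivative_real_field) (auto intro!: derivative_eq_intros simp: algebra_simps)
    show "isCont (\<lambda>x. b * cgauss w b x - 2 * w * (of_real x * cgauss w b x)) x" for x
      unfolding cgauss_def by (intro continuous_intros)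
  qed (use int lim in auto)
  then show "2 * w * (\<integral>x. of_real x * cgauss w b x \<partial>lborel) = b * (\<integral>x. cgauss w b x \<partial>lborel)"
    using int by simp
  have "(\<integral>x. cgauss w 0 x - 2 * w * ((of_real x)\<^sup>2 * cgauss w 0 x) \<partial>lborel) = 0"
  proof (rule integral_deriv_eq_0[where F = "\<lambda>x. of_real x * cgauss w 0 x"])
    show "((\<lambda>x. of_real x * cgauss w 0 x) has_vector_derivative cgauss w 0 x - 2 * w * ((of_real x)\<^sup>2 * cgauss w 0 x)) (at x)" for x
      unfolding cgauss_def
      by (rule has_vector_derivative_real_field) (auto intro!: derivative_eq_intros simp: algebra_simps power2_eq_square)
    show "isCont (\<lambda>x. cgauss w 0 x - 2 * w * ((of_real x)\<^sup>2 * cgauss w 0 x)) x" for x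
      unfolding cgauss_def by (intro continuous_intros)
  qed (use int lim in auto)
  then show "2 * w * (\<integral>x. (of_real x)\<^sup>2 * cgauss w 0 x \<partial>lborel) = (\<integral>x. cgauss w 0 x \<partial>lborel)"
    using int by simp
qed

lemma integral_cgauss:
  assumes w: "Re w > 0"
  shows "(\<integral>x. cgauss w b x \<partial>lborel) = (\<integral>x. cgauss w 0 x \<partial>lborel) * exp (b\<^sup>2 / (4 * w))"
proof -
  have w0: "w \<noteq> 0" using w by auto
  define F where "F = (\<lambda>s::real. \<integral>x. cgauss w (of_real s * b) x \<partial>lborel)"
  define K where "K = (\<lambda>s. F s * exp (- (of_real s)\<^sup>2 * b\<^sup>2 / (4 * w)))"
  have F': "(F has_vector_derivative of_real s * b\<^sup>2 / (2 * w) * F s) (at s)" if s: "s \<in> {-1<..<2}" for s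
  proof -
    have "(F has_vector_derivative (\<integral>x. b * (of_real x * cgauss w (of_real s * b) x) \<partial>lborel)) (at s)"
      unfolding F_def
    proof (rule has_vector_derivative_integral[where T = "{-1<..<2}" and
          g = "\<lambda>x. norm b * (exp ((2 * norm b)\<^sup>2 / (2 * Re w)) * (\<bar>x\<bar> ^ 1 * exp (- (Re w / 2) * x\<^sup>2)))"])
      fix u x :: real assume u: "u \<in> {-1<..<2}"
      have "norm (of_real u * b) \<le> 2 * norm b"
        using u by (auto simp: norm_mult intro!: mult_right_mono)
      from norm_cgauss_le[OF w this, of x]
      show "norm (b * (of_real x * cgauss w (of_real u * b) x))
          \<le> norm b * (exp ((2 * norm b)\<^sup>2 / (2 * Re w)) * (\<bar>x\<bar> ^ 1 * exp (- (Re w / 2) * x\<^sup>2)))"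
        unfolding norm_mult by (intro mult_left_mono) (auto simp: mult.left_commute[of _ "\<bar>x\<bar>"] intro!: mult_left_mono)
      show "((\<lambda>s. cgauss w (of_real s * b) x) has_vector_derivative b * (of_real x * cgauss w (of_real u * b) x)) (at u)"
        unfolding cgauss_def
        by (rule has_vector_derivative_real_field[where f = "\<lambda>z. exp (- w * (of_real x)\<^sup>2 + z * b * of_real x)"])
          (auto intro!: derivative_eq_intros simp: algebra_simps)
      show "integrable lborel (cgauss w (of_real u * b))"
        using integrable_power_cgauss[OF w, of 0] by simp
    next
      show "integrable lborel (\<lambda>x. norm b * (exp ((2 * norm b)\<^sup>2 / (2 * Re w)) * (\<bar>x\<bar> ^ 1 * exp (- (Re w / 2) * x\<^sup>2))))"
        using w by (intro integrable_mult_right integrable_power_gaussian) auto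
    qed (use s in auto)
    also have "(\<integral>x. b * (of_real x * cgauss w (of_real s * b) x) \<partial>lborel) = of_real s * b\<^sup>2 / (2 * w) * F s"
      using cgauss_integral_by_parts(1)[OF w, of "of_real s * b"] w0
      unfolding F_def by (simp add: field_simps power2_eq_square)
    finally show ?thesis .
  qed
  have "(K has_vector_derivative 0) (at s)" if "s \<in> {-1<..<2}" for s
  proof -
    have E: "((\<lambda>s. exp (- (of_real s)\<^sup>2 * b\<^sup>2 / (4 * w))) has_vector_derivative
       - (of_real s * b\<^sup>2 / (2 * w)) * exp (- (of_real s)\<^sup>2 * b\<^sup>2 / (4 * w))) (at s)"
      using w0 by (intro has_vector_derivative_real_field)
        (auto intro!: derivative_eq_intros simp: field_simps)
    show ?thesis
      unfolding K_def
      by (rule has_vector_derivative_eq_rhs[OF has_vector_derivative_mult[OF F'[OF that] E]]) (simp add: algebra_simps)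
  qed
  then obtain c where "\<And>s. s \<in> {-1<..<2} \<Longrightarrow> K s = c"
    using has_vector_derivative_zero_constant[of "{-1<..<2}" K] has_vector_derivative_at_within by (metis convex_real_interval(8))
  from this[of 0] this[of 1] have "K 1 = K 0" by simp
  then show ?thesis
    by (simp add: K_def F_def field_simps exp_minus)
qed

lemma integral_cgauss_square:
  assumes w: "Re w > 0"
  shows "(\<integral>x. cgauss w 0 x \<partial>lborel)\<^sup>2 = of_real pi / w"
proof -
  define v where "v = (\<lambda>t::real. of_real (Re w) + of_real t * \<i> * of_real (Im w))"
  have v: "Re (v t) = Re w" for t
    by (simp add: v_def)
  have v0: "v t \<noteq> 0" for t
    using v[of t] w by auto
  define P where "P = (\<lambda>t. \<integral>x. cgauss (v t) 0 x \<partial>lborel)"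
  have P': "(P has_vector_derivative - \<i> * of_real (Im w) / (2 * v t) * P t) (at t)" for t
  proof -
    have "(P has_vector_derivative (\<integral>x. - \<i> * of_real (Im w) * ((of_real x)\<^sup>2 * cgauss (v t) 0 x) \<partial>lborel)) (at t)"
      unfolding P_def
    proof (rule has_vector_derivative_integral[where T = UNIV and g = "\<lambda>x. \<bar>Im w\<bar> * (\<bar>x\<bar> ^ 2 * exp (- (Re w / 2) * x\<^sup>2))"])
      fix u x :: real
      show "norm (- \<i> * of_real (Im w) * ((of_real x)\<^sup>2 * cgauss (v u) 0 x)) \<le> \<bar>Im w\<bar> * (\<bar>x\<bar> ^ 2 * exp (- (Re w / 2) * x\<^sup>2))"
        using norm_cgauss_le[of "v u" 0 0 x] w unfolding v norm_mult norm_power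
        by (auto intro!: mult_left_mono)
      show "((\<lambda>t. cgauss (v t) 0 x) has_vector_derivative - \<i> * of_real (Im w) * ((of_real x)\<^sup>2 * cgauss (v u) 0 x)) (at u)"
        unfolding cgauss_def v_def
        by (rule has_vector_derivative_real_field[where f = "\<lambda>z. exp (- (of_real (Re w) + z * \<i> * of_real (Im w)) * (of_real x)\<^sup>2 + 0 * of_real x)"])
          (auto intro!: derivative_eq_intros simp: algebra_simps)
      show "integrable lborel (cgauss (v u) 0)"
        using integrable_power_cgauss[of "v u" 0] w v by simp
    next
      show "integrable lborel (\<lambda>x. \<bar>Im w\<bar> * (\<bar>x\<bar> ^ 2 * exp (- (Re w / 2) * x\<^sup>2)))"
        using w by (intro integrable_mult_right integrable_power_gaussian) auto
    qed auto
    also have "(\<integral>x. - \<i> * of_real (Im w) * ((of_real x)\<^sup>2 * cgauss (v t) 0 x) \<partial>lborel) = - \<i> * of_real (Im w) / (2 * v t) * P t"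
      using cgauss_integral_by_parts(2)[of "v t"] w v0[of t] unfolding P_def v
      by (simp add: field_simps)
    finally show ?thesis .
  qed
  have v': "(v has_vector_derivative \<i> * of_real (Im w)) (at t)" for t
    unfolding v_def by (rule has_vector_derivative_real_field) (auto intro!: derivative_eq_intros)
  have "((\<lambda>t. P t * P t * v t) has_vector_derivative 0) (at t)" for t
    by (rule has_vector_derivative_eq_rhs[OF has_vector_derivative_mult[OF has_vector_derivative_mult[OF P' P'] v']])
      (use v0[of t] in \<open>simp add: field_simps\<close>)
  then obtain c where "\<And>s. P s * P s * v s = c"
    using has_vector_derivative_zero_constant[of UNIV "\<lambda>t. P t * P t * v t"] by auto
  from this[of 0] this[of 1] have "P 1 * P 1 * v 1 = P 0 * P 0 * v 0" by simp
  moreover have "P 0 = of_real (sqrt (pi / Re w))"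
    using integral_gaussian_real[OF w]
    by (simp add: P_def v_def cgauss_def exp_of_real flip: of_real_power of_real_mult of_real_minus)
  moreover have "v 1 = w"
    by (simp add: v_def complex_eq_iff)
  moreover have "v 0 = of_real (Re w)"
    by (simp add: v_def)
  ultimately have "P 1 * P 1 * w = of_real (sqrt (pi / Re w) * sqrt (pi / Re w) * Re w)"
    by (simp only: of_real_mult)
  also have "sqrt (pi / Re w) * sqrt (pi / Re w) * Re w = pi"
    using w by simp
  finally have "(P 1)\<^sup>2 = of_real pi / w"
    using w by (cases "w = 0") (auto simp: field_simps power2_eq_square)
  then show ?thesis
    using \<open>v 1 = w\<close> by (simp add: P_def)
qed

lemma power2_norm_sum_Basis: "(norm (x::'a::euclidean_space))\<^sup>2 = (\<Sum>b\<in>Basis. (x \<bullet> b)\<^sup>2)"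
  unfolding power2_norm_eq_inner by (subst euclidean_inner) (simp add: power2_eq_square)

lemma
  fixes \<beta> :: "'a::euclidean_space \<Rightarrow> complex"
  assumes w: "Re w > 0"
  shows integrable_gaussian_euclidean:
      "integrable lborel (\<lambda>x::'a. exp (- w * of_real ((norm x)\<^sup>2) + (\<Sum>b\<in>Basis. \<beta> b * of_real (x \<bullet> b))))"
    and integral_gaussian_euclidean:
      "(\<integral>x. exp (- w * of_real ((norm x)\<^sup>2) + (\<Sum>b\<in>Basis. \<beta> b * of_real (x \<bullet> b))) \<partial>lborel)
        = (\<integral>t. cgauss w 0 t \<partial>lborel) ^ DIM('a) * exp ((\<Sum>b\<in>Basis. (\<beta> b)\<^sup>2) / (4 * w))"
proof -
  have eq: "exp (- w * of_real ((norm x)\<^sup>2) + (\<Sum>b\<in>Basis. \<beta> b * of_real (x \<bullet> b)))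
      = (\<Prod>b\<in>Basis. cgauss w (\<beta> b) (x \<bullet> b))" for x :: 'a
    by (simp add: cgauss_def power2_norm_sum_Basis sum_distrib_left flip: exp_sum sum.distrib sum_negf)
  have int: "integrable lborel (cgauss w b)" for b
    using integrable_power_cgauss[OF w, of 0] by simp
  show "integrable lborel (\<lambda>x::'a. exp (- w * of_real ((norm x)\<^sup>2) + (\<Sum>b\<in>Basis. \<beta> b * of_real (x \<bullet> b))))"
    unfolding eq by (intro integrable_lborel_prod int)
  show "(\<integral>x. exp (- w * of_real ((norm x)\<^sup>2) + (\<Sum>b\<in>Basis. \<beta> b * of_real (x \<bullet> b))) \<partial>lborel)
        = (\<integral>t. cgauss w 0 t \<partial>lborel) ^ DIM('a) * exp ((\<Sum>b\<in>Basis. (\<beta> b)\<^sup>2) / (4 * w))"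
    unfolding eq
    by (subst integral_lborel_prod[OF int])
      (simp add: integral_cgauss[OF w, of "\<beta> _"] prod.distrib sum_divide_distrib exp_sum)
qed

lemma norm_integral_cgauss:
  assumes w: "Re w > 0"
  shows "norm (\<integral>x. cgauss w 0 x \<partial>lborel) = sqrt (pi / norm w)"
  using arg_cong[OF integral_cgauss_square[OF w], of "\<lambda>z. sqrt (norm z)"]
  by (simp add: norm_power norm_divide)

lemma
  assumes r: "r > 0"
  shows integrable_real_gaussian: "integrable lborel (\<lambda>x::'a::euclidean_space. exp (- r * (norm x)\<^sup>2))"
    and nn_integral_real_gaussian:
      "(\<integral>\<^sup>+x. ennreal (exp (- r * (norm (x::'a))\<^sup>2)) \<partial>lborel) = ennreal (sqrt (pi / r) ^ DIM('a))"
proof -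
  have w: "Re (of_real r) > 0" using r by simp
  have eq: "exp (- (of_real r::complex) * of_real ((norm x)\<^sup>2) + (\<Sum>b\<in>Basis. 0 * of_real (x \<bullet> b)))
     = of_real (exp (- r * (norm x)\<^sup>2))" for x :: 'a
    by (simp flip: of_real_power of_real_mult of_real_minus exp_of_real)
  note int = integrable_gaussian_euclidean[OF w, of "\<lambda>_::'a. 0", unfolded eq]
    and val = integral_gaussian_euclidean[OF w, of "\<lambda>_::'a. 0", unfolded eq]
  show i: "integrable lborel (\<lambda>x::'a. exp (- r * (norm x)\<^sup>2))"
    using int by (simp only: complex_of_real_integrable_eq)
  have "(\<integral>t. cgauss (of_real r) 0 t \<partial>lborel) = complex_of_real (sqrt (pi / r))"
    using integral_gaussian_real[OF r]
    by (simp add: cgauss_def exp_of_real flip: of_real_power of_real_mult of_real_minus)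
  with val have "(\<integral>x. exp (- r * (norm (x::'a))\<^sup>2) \<partial>lborel) = sqrt (pi / r) ^ DIM('a)"
    by (simp only: integral_complex_of_real) (simp flip: of_real_power)
  then show "(\<integral>\<^sup>+x. ennreal (exp (- r * (norm (x::'a))\<^sup>2)) \<partial>lborel) = ennreal (sqrt (pi / r) ^ DIM('a))"
    by (subst nn_integral_eq_integral[OF i]) auto
qed

section \<open>The heat kernel at complex time\<close>

definition heat :: "complex \<Rightarrow> 'a::euclidean_space \<Rightarrow> complex" where
  "heat w u = (\<integral>t. cgauss w 0 t \<partial>lborel) ^ DIM('a) * exp (- of_real (pi\<^sup>2 * (norm u)\<^sup>2) / w)"

lemma heat_eq_fourier:
  fixes u :: "'a::euclidean_space"
  assumes w: "Re w > 0"
  shows "heat w u = (\<integral>\<xi>. exp (- w * of_real ((norm \<xi>)\<^sup>2)) * exp (2 * of_real pi * \<i> * of_real (u \<bullet> \<xi>)) \<partial>lborel)"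
proof -
  have "exp (- w * of_real ((norm \<xi>)\<^sup>2)) * exp (2 * of_real pi * \<i> * of_real (u \<bullet> \<xi>))
      = exp (- w * of_real ((norm \<xi>)\<^sup>2) + (\<Sum>b\<in>Basis. 2 * of_real pi * \<i> * of_real (u \<bullet> b) * of_real (\<xi> \<bullet> b)))" for \<xi> :: 'a
    unfolding exp_add[symmetric]
    by (subst euclidean_inner) (simp add: sum_distrib_left mult_ac)
  moreover have "(\<Sum>b\<in>Basis. (2 * of_real pi * \<i> * of_real (u \<bullet> b))\<^sup>2) / (4 * w) = - of_real (pi\<^sup>2 * (norm u)\<^sup>2) / w"
    by (simp add: power2_norm_sum_Basis power_mult_distrib sum_distrib_left sum_divide_distrib sum_negf)
  ultimately show ?thesis
    by (simp only: integral_gaussian_euclidean[OF w] heat_def)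
qed

lemma norm_heat:
  assumes w: "Re w = 1"
  shows "norm (heat w (u::'a::euclidean_space)) = sqrt (pi / norm w) ^ DIM('a) * exp (- pi\<^sup>2 / (norm w)\<^sup>2 * (norm u)\<^sup>2)"
proof -
  have "Re (- of_real (pi\<^sup>2 * (norm u)\<^sup>2) / w) = - pi\<^sup>2 / (norm w)\<^sup>2 * (norm u)\<^sup>2"
    using w by (simp add: Re_divide cmod_power2)
  then show ?thesis
    using w by (simp add: heat_def norm_mult norm_power norm_integral_cgauss)
qed

lemma measurable_heat [measurable (raw)]:
  assumes [measurable]: "w \<in> borel_measurable M" "u \<in> borel_measurable M"
  shows "(\<lambda>p. heat (w p) (u p)) \<in> borel_measurable M"
  unfolding heat_def cgauss_def by measurable

text \<open>With \<open>heat w\<close> replaced by its modulus, this Gram kernel would decay in \<open>z - z'\<close> only at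
  the scale \<open>norm w\<close>.  The oscillation improves the scale to \<open>1\<close>, which is the gain that lowers the
  admissible \<open>\<delta>\<close> from \<open>n\<close> to \<open>n / 2\<close>.\<close>

lemma norm_heat_gram:
  fixes z z' :: "'a::euclidean_space"
  assumes w: "Re w = 1"
  defines "a \<equiv> 1 / (norm w)\<^sup>2"
  shows "norm (\<integral>x. of_real (exp (- pi\<^sup>2 * a * (norm x)\<^sup>2)) * heat w (x - z) * cnj (heat w (x - z')) \<partial>lborel)
    = (pi / norm w) ^ DIM('a) * sqrt (1 / (3 * pi * a)) ^ DIM('a)
      * exp (- (pi\<^sup>2 / 3) * (a * ((norm z)\<^sup>2 + (norm z')\<^sup>2) + (norm (z - z'))\<^sup>2))"
proof -
  have "w \<noteq> 0" using w by auto
  then have a: "a > 0" by (simp add: a_def)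
  define c where "c = (\<integral>t. cgauss w 0 t \<partial>lborel) ^ DIM('a)"
  define d where "d = (\<integral>t. cgauss (of_real (3 * pi\<^sup>2 * a)) 0 t \<partial>lborel) ^ DIM('a)"
  define W where "W = 1 / w"
  have W: "Re W = a" "(Im W)\<^sup>2 = a - a\<^sup>2"
  proof -
    show 1: "Re W = a"
      using w by (simp add: W_def a_def Re_divide cmod_power2)
    have "(norm W)\<^sup>2 = a"
      by (simp add: W_def a_def norm_divide power_divide)
    then show "(Im W)\<^sup>2 = a - a\<^sup>2"
      using 1 by (simp add: cmod_power2)
  qed
  have Wc: "W + cnj W = of_real (2 * a)"
    using W by (simp add: complex_add_cnj)
  define \<beta> where "\<beta> = (\<lambda>b. 2 * of_real (pi\<^sup>2) * (W * of_real (z \<bullet> b) + cnj W * of_real (z' \<bullet> b)))"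
  define p where "p = - of_real (pi\<^sup>2) * (W * of_real ((norm z)\<^sup>2) + cnj W * of_real ((norm z')\<^sup>2))"
  have nc: "norm c = sqrt (pi / norm w) ^ DIM('a)" and nd: "norm d = sqrt (1 / (3 * pi * a)) ^ DIM('a)"
    using w a by (simp_all add: c_def d_def norm_power norm_integral_cgauss power2_eq_square norm_mult mult.assoc)
  have *: "of_real (exp (- pi\<^sup>2 * a * (norm x)\<^sup>2)) * heat w (x - z) * cnj (heat w (x - z'))
     = c * cnj c * exp p * exp (- of_real (3 * pi\<^sup>2 * a) * of_real ((norm x)\<^sup>2) + (\<Sum>b\<in>Basis. \<beta> b * of_real (x \<bullet> b)))"
    (is "?l = ?r") for x
  proof -
    have h: "heat w y = c * exp (- of_real (pi\<^sup>2) * (W * of_real ((norm y)\<^sup>2)))" for y :: 'a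
      by (simp add: heat_def c_def W_def)
    have n: "(norm (x - y))\<^sup>2 = (norm x)\<^sup>2 - 2 * (x \<bullet> y) + (norm y)\<^sup>2" for y
      by (simp add: power2_norm_eq_inner inner_diff algebra_simps inner_commute)
    have "?l = c * cnj c * exp (- of_real (pi\<^sup>2) * (of_real (a * (norm x)\<^sup>2)
       + W * of_real ((norm (x - z))\<^sup>2) + cnj W * of_real ((norm (x - z'))\<^sup>2)))"
    proof -
      have "of_real (exp (- pi\<^sup>2 * a * (norm x)\<^sup>2)) = exp (- of_real (pi\<^sup>2) * (of_real (a * (norm x)\<^sup>2)) :: complex)"
        by (simp add: mult.assoc flip: exp_of_real)
      moreover have "cnj (heat w y) = cnj c * exp (- of_real (pi\<^sup>2) * (cnj W * of_real ((norm y)\<^sup>2)))" for y :: 'a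
        unfolding h by (simp add: exp_cnj)
      ultimately show ?thesis
        unfolding h distrib_left exp_add by (simp only: mult_ac)
    qed
    also have "(of_real (a * (norm x)\<^sup>2) + W * of_real ((norm (x - z))\<^sup>2) + cnj W * of_real ((norm (x - z'))\<^sup>2))
      = of_real (3 * a * (norm x)\<^sup>2) - 2 * (W * of_real (x \<bullet> z) + cnj W * of_real (x \<bullet> z'))
        + (W * of_real ((norm z)\<^sup>2) + cnj W * of_real ((norm z')\<^sup>2))"
    proof -
      have "of_real (3 * a * (norm x)\<^sup>2) = of_real (a * (norm x)\<^sup>2) + (W + cnj W) * of_real ((norm x)\<^sup>2)"
        unfolding Wc by simp
      then show ?thesis unfolding n by (simp add: algebra_simps)
    qed
    also have "- of_real (pi\<^sup>2) * (of_real (3 * a * (norm x)\<^sup>2) - 2 * (W * of_real (x \<bullet> z) + cnj W * of_real (x \<bullet> z'))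
        + (W * of_real ((norm z)\<^sup>2) + cnj W * of_real ((norm z')\<^sup>2)))
      = p + (- of_real (3 * pi\<^sup>2 * a) * of_real ((norm x)\<^sup>2) + 2 * of_real (pi\<^sup>2) * (W * of_real (x \<bullet> z) + cnj W * of_real (x \<bullet> z')))"
      by (simp add: p_def algebra_simps)
    also have "2 * of_real (pi\<^sup>2) * (W * of_real (x \<bullet> z) + cnj W * of_real (x \<bullet> z')) = (\<Sum>b\<in>Basis. \<beta> b * of_real (x \<bullet> b))"
      unfolding \<beta>_def euclidean_inner[of x z] euclidean_inner[of x z']
      by (simp add: sum_distrib_left algebra_simps sum.distrib)
    finally show ?thesis
      by (simp add: exp_add mult_ac)
  qed
  have r: "Re (of_real (3 * pi\<^sup>2 * a)) > 0"
    using a by simp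
  have "(\<integral>x. of_real (exp (- pi\<^sup>2 * a * (norm x)\<^sup>2)) * heat w (x - z) * cnj (heat w (x - z')) \<partial>lborel)
    = c * cnj c * exp p * (d * exp ((\<Sum>b\<in>Basis. (\<beta> b)\<^sup>2) / (4 * of_real (3 * pi\<^sup>2 * a))))"
    unfolding * integral_mult_right_zero integral_gaussian_euclidean[OF r] d_def ..
  then have "norm (\<integral>x. of_real (exp (- pi\<^sup>2 * a * (norm x)\<^sup>2)) * heat w (x - z) * cnj (heat w (x - z')) \<partial>lborel)
    = (norm c)\<^sup>2 * norm d * exp (Re p + Re ((\<Sum>b\<in>Basis. (\<beta> b)\<^sup>2) / (4 * of_real (3 * pi\<^sup>2 * a))))"
    by (simp add: norm_mult exp_add power2_eq_square)
  also have "Re p + Re ((\<Sum>b\<in>Basis. (\<beta> b)\<^sup>2) / (4 * of_real (3 * pi\<^sup>2 * a)))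
      = - (pi\<^sup>2 / 3) * (a * ((norm z)\<^sup>2 + (norm z')\<^sup>2) + (norm (z - z'))\<^sup>2)"
  proof -
    have \<beta>: "Re ((\<beta> b)\<^sup>2 / (4 * of_real (3 * pi\<^sup>2 * a)))
       = pi\<^sup>2 * a * ((z \<bullet> b)\<^sup>2 + (z' \<bullet> b)\<^sup>2) - (pi\<^sup>2 / 3) * (a * ((z \<bullet> b)\<^sup>2 + (z' \<bullet> b)\<^sup>2) + ((z - z') \<bullet> b)\<^sup>2)" for b
    proof -
      have "Re ((\<beta> b)\<^sup>2 / (4 * of_real (3 * pi\<^sup>2 * a))) = pi\<^sup>2 / (3 * a) * Re ((W * of_real (z \<bullet> b) + cnj W * of_real (z' \<bullet> b))\<^sup>2)"
      proof -
        have "(\<beta> b)\<^sup>2 / (4 * of_real (3 * pi\<^sup>2 * a)) = of_real (pi\<^sup>2 / (3 * a)) * (W * of_real (z \<bullet> b) + cnj W * of_real (z' \<bullet> b))\<^sup>2"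
          using a unfolding \<beta>_def power_mult_distrib by (simp add: power2_eq_square)
        then show ?thesis
          by (simp only: Re_complex_of_real times_complex.sel Im_complex_of_real mult_zero_left diff_zero)
      qed
      also have "Re ((W * of_real (z \<bullet> b) + cnj W * of_real (z' \<bullet> b))\<^sup>2)
         = (a * (z \<bullet> b + z' \<bullet> b))\<^sup>2 - (Im W)\<^sup>2 * (z \<bullet> b - z' \<bullet> b)\<^sup>2"
        using W(1) by (simp add: Re_power2 algebra_simps power2_eq_square)
      also have "pi\<^sup>2 / (3 * a) * \<dots> = pi\<^sup>2 * a * ((z \<bullet> b)\<^sup>2 + (z' \<bullet> b)\<^sup>2) - (pi\<^sup>2 / 3) * (a * ((z \<bullet> b)\<^sup>2 + (z' \<bullet> b)\<^sup>2) + ((z - z') \<bullet> b)\<^sup>2)"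
        unfolding W(2) using a by (simp add: field_simps power2_eq_square inner_diff_left)
      finally show ?thesis .
    qed
    have "Re p = - pi\<^sup>2 * a * ((norm z)\<^sup>2 + (norm z')\<^sup>2)"
      using W(1) by (simp add: p_def algebra_simps flip: of_real_power)
    then show ?thesis
      unfolding sum_divide_distrib Re_sum \<beta> power2_norm_sum_Basis
      by (simp only: sum_subtractf sum.distrib flip: sum_distrib_left)
  qed
  finally show ?thesis
    by (simp add: nc nd power_mult_distrib[symmetric] power2_eq_square)
qed

lemma nn_integral_lborel_shift:
  fixes f :: "'a::euclidean_space \<Rightarrow> ennreal"
  assumes [measurable]: "f \<in> borel_measurable borel"
  shows "(\<integral>\<^sup>+x. f (x + c) \<partial>lborel) = (\<integral>\<^sup>+x. f x \<partial>lborel)"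
proof -
  have "(\<integral>\<^sup>+x. f x \<partial>lborel) = (\<integral>\<^sup>+x. f x \<partial>distr lborel borel ((+) c))"
    by (simp only: lborel_distr_plus)
  also have "\<dots> = (\<integral>\<^sup>+x. f (x + c) \<partial>lborel)"
    by (subst nn_integral_distr) (auto simp: add.commute)
  finally show ?thesis ..
qed

lemma
  fixes f :: "'a::euclidean_space \<Rightarrow> complex"
  assumes [measurable]: "f \<in> borel_measurable borel"
  shows integral_lborel_shift: "(\<integral>x. f (x + c) \<partial>lborel) = (\<integral>x. f x \<partial>lborel)"
    and integrable_lborel_shift: "integrable lborel (\<lambda>x. f (x + c)) \<longleftrightarrow> integrable lborel f"
proof -
  show "(\<integral>x. f (x + c) \<partial>lborel) = (\<integral>x. f x \<partial>lborel)"
    by (subst (2) lborel_distr_plus[of c, symmetric], subst integral_distr) (auto simp: add.commute)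
  show "integrable lborel (\<lambda>x. f (x + c)) \<longleftrightarrow> integrable lborel f"
    by (subst (2) lborel_distr_plus[of c, symmetric], subst integrable_distr_eq) (auto simp: add.commute)
qed

lemma (in pair_sigma_finite)
  fixes f g :: "_ \<Rightarrow> 'c::{real_normed_field, banach, second_countable_topology}"
  assumes f: "integrable M1 f" and g: "integrable M2 g"
  shows integrable_mult_pair: "integrable (M1 \<Otimes>\<^sub>M M2) (\<lambda>p. f (fst p) * g (snd p))"
    and integral_mult_pair: "(\<integral>p. f (fst p) * g (snd p) \<partial>(M1 \<Otimes>\<^sub>M M2)) = (\<integral>x. f x \<partial>M1) * (\<integral>y. g y \<partial>M2)"
proof -
  have [measurable]: "f \<in> borel_measurable M1" "g \<in> borel_measurable M2"
    using f g by auto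
  show int: "integrable (M1 \<Otimes>\<^sub>M M2) (\<lambda>p. f (fst p) * g (snd p))"
    using f g by (intro Fubini_integrable) (auto simp: norm_mult)
  show "(\<integral>p. f (fst p) * g (snd p) \<partial>(M1 \<Otimes>\<^sub>M M2)) = (\<integral>x. f x \<partial>M1) * (\<integral>y. g y \<partial>M2)"
    using integral_fst'[OF int] by simp
qed

lemma borel_measurable_cnj [measurable]: "cnj \<in> borel_measurable borel"
  by (intro borel_measurable_continuous_onI continuous_intros)

lemma norm_heat_le:
  assumes "Re w = 1"
  shows "norm (heat w (u::'a::euclidean_space)) \<le> sqrt (pi / norm w) ^ DIM('a)"
  unfolding norm_heat[OF assms] by (intro mult_right_le_one_le) auto

definition heat_conv :: "complex \<Rightarrow> ('a::euclidean_space \<Rightarrow> complex) \<Rightarrow> 'a \<Rightarrow> complex" where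
  "heat_conv w g x = (\<integral>z. heat w (x - z) * g z \<partial>lborel)"

lemma integrable_heat_mult:
  fixes g :: "'a::euclidean_space \<Rightarrow> complex"
  assumes w: "Re w = 1" and g: "integrable lborel g"
  shows "integrable lborel (\<lambda>z. heat w (x - z) * g z)"
proof (rule Bochner_Integration.integrable_bound)
  show "integrable lborel (\<lambda>z. sqrt (pi / norm w) ^ DIM('a) * norm (g z))"
    using g by simp
  show "AE z in lborel. norm (heat w (x - z) * g z) \<le> norm (sqrt (pi / norm w) ^ DIM('a) * norm (g z))"
    using norm_heat_le[OF w] by (auto simp: norm_mult intro!: mult_right_mono AE_I2)
qed (use g in auto)

lemma measurable_heat_conv [measurable (raw)]:
  assumes [measurable]: "f \<in> borel_measurable borel" "w \<in> borel_measurable M" "x \<in> borel_measurable M"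
  shows "(\<lambda>p. heat_conv (w p) f (x p)) \<in> borel_measurable M"
  unfolding heat_conv_def by measurable

interpretation lborel_triple: pair_sigma_finite "lborel :: 'a::euclidean_space measure"
  "lborel \<Otimes>\<^sub>M lborel :: ('b::euclidean_space \<times> 'c::euclidean_space) measure"
  by unfold_locales

lemma heat_conv_weighted_L2:
  fixes g :: "'a::euclidean_space \<Rightarrow> complex"
  assumes w: "Re w = 1" and g: "integrable lborel g"
    and G: "AE x in lborel. norm (g x) \<le> G" and G0: "G > 0"
  shows "(\<integral>\<^sup>+x. ennreal (exp (- pi\<^sup>2 / (norm w)\<^sup>2 * (norm x)\<^sup>2) * (norm (heat_conv w g x))\<^sup>2) \<partial>lborel)
    \<le> ennreal (G\<^sup>2 * norm w ^ DIM('a))"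
proof -
  have [measurable]: "g \<in> borel_measurable borel" using g by auto
  define s where "s = norm w"
  define a where "a = 1 / s\<^sup>2"
  have "w \<noteq> 0" using w by auto
  then have s: "s > 0" and a: "a > 0" by (auto simp: s_def a_def)
  define E where "E = (\<lambda>x::'a. exp (- pi\<^sup>2 * a * (norm x)\<^sup>2))"
  have [measurable]: "E \<in> borel_measurable borel" unfolding E_def by measurable
  have iE: "integrable lborel E"
    using integrable_real_gaussian[of "pi\<^sup>2 * a"] a unfolding E_def by simp
  define \<Theta> where "\<Theta> = (\<lambda>x p. of_real (E x) * heat w (x - fst p) * cnj (heat w (x - snd p)) * (g (fst p) * cnj (g (snd p))))"
  define M where "M = (\<lambda>p. \<integral>x. of_real (E x) * heat w (x - fst p) * cnj (heat w (x - snd p)) \<partial>lborel)"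
  define B where "B = sqrt (pi / s) ^ DIM('a)"
  have B: "norm (heat w u) \<le> B" for u :: 'a
    using norm_heat_le[OF w, of u] by (simp add: B_def s_def)
  have B0: "B \<ge> 0" using s by (simp add: B_def)
  have \<Theta>_int: "integrable (lborel \<Otimes>\<^sub>M (lborel \<Otimes>\<^sub>M lborel)) (\<lambda>q. \<Theta> (fst q) (snd q))"
  proof (rule Bochner_Integration.integrable_bound)
    show "integrable (lborel \<Otimes>\<^sub>M (lborel \<Otimes>\<^sub>M lborel))
        (\<lambda>q::'a \<times> 'a \<times> 'a. (B * B) * (E (fst q) * (norm (g (fst (snd q))) * norm (g (snd (snd q))))))"
      using iE g by (intro integrable_mult_right lborel_triple.integrable_mult_pair lborel_pair.integrable_mult_pair
          [where f = "\<lambda>x. norm (g x)" and g = "\<lambda>x. norm (g x)"]) auto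
    show "AE q in lborel \<Otimes>\<^sub>M (lborel \<Otimes>\<^sub>M lborel). norm (\<Theta> (fst q) (snd q))
        \<le> norm ((B * B) * (E (fst q) * (norm (g (fst (snd q))) * norm (g (snd (snd q))))))"
    proof (rule AE_I2)
      fix q :: "'a \<times> 'a \<times> 'a"
      have "norm (heat w (fst q - fst (snd q))) * norm (heat w (fst q - snd (snd q))) \<le> B * B"
        using B B0 by (intro mult_mono) auto
      then have "norm (heat w (fst q - fst (snd q))) * norm (heat w (fst q - snd (snd q)))
          * (E (fst q) * (norm (g (fst (snd q))) * norm (g (snd (snd q)))))
        \<le> B * B * (E (fst q) * (norm (g (fst (snd q))) * norm (g (snd (snd q)))))"
        by (intro mult_right_mono) (auto simp: E_def)
      then show "norm (\<Theta> (fst q) (snd q))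
        \<le> norm ((B * B) * (E (fst q) * (norm (g (fst (snd q))) * norm (g (snd (snd q))))))"
        using B0 by (simp add: \<Theta>_def norm_mult E_def mult_ac)
    qed
    show "(\<lambda>q. \<Theta> (fst q) (snd q)) \<in> borel_measurable (lborel \<Otimes>\<^sub>M (lborel \<Otimes>\<^sub>M lborel))"
      unfolding \<Theta>_def by measurable
  qed
  have \<Theta>_int': "integrable (lborel \<Otimes>\<^sub>M (lborel \<Otimes>\<^sub>M lborel)) (case_prod \<Theta>)"
    using \<Theta>_int by (simp add: split_beta')
  have conv: "(\<integral>p. \<Theta> x p \<partial>(lborel \<Otimes>\<^sub>M lborel)) = of_real (E x * (norm (heat_conv w g x))\<^sup>2)" for x
  proof -
    have "(\<integral>p. \<Theta> x p \<partial>(lborel \<Otimes>\<^sub>M lborel))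
        = (\<integral>p. of_real (E x) * ((heat w (x - fst p) * g (fst p)) * cnj (heat w (x - snd p) * g (snd p))) \<partial>(lborel \<Otimes>\<^sub>M lborel))"
      by (simp add: \<Theta>_def mult_ac)
    also have "\<dots> = of_real (E x) * (\<integral>p. ((heat w (x - fst p) * g (fst p)) * cnj (heat w (x - snd p) * g (snd p))) \<partial>(lborel \<Otimes>\<^sub>M lborel))"
      by (rule integral_mult_right_zero)
    also have "(\<integral>p. ((heat w (x - fst p) * g (fst p)) * cnj (heat w (x - snd p) * g (snd p))) \<partial>(lborel \<Otimes>\<^sub>M lborel))
        = heat_conv w g x * cnj (heat_conv w g x)"
      using lborel_pair.integral_mult_pair[of "\<lambda>z. heat w (x - z) * g z" "\<lambda>z. cnj (heat w (x - z) * g z)"]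
        integrable_heat_mult[OF w g, of x] integrable_cnj[of lborel "\<lambda>z. heat w (x - z) * g z"]
        Bochner_Integration.integral_cnj[of lborel "\<lambda>z. heat w (x - z) * g z"]
      by (simp only: heat_conv_def)
    finally show ?thesis
      by (simp only: of_real_mult complex_norm_square)
  qed
  have int: "integrable lborel (\<lambda>x. E x * (norm (heat_conv w g x))\<^sup>2)"
    using lborel_triple.integrable_fst[OF \<Theta>_int'] unfolding conv complex_of_real_integrable_eq .
  have "of_real (\<integral>x. E x * (norm (heat_conv w g x))\<^sup>2 \<partial>lborel) = (\<integral>x. (\<integral>p. \<Theta> x p \<partial>(lborel \<Otimes>\<^sub>M lborel)) \<partial>lborel)"
    unfolding conv integral_complex_of_real ..
  also have "\<dots> = (\<integral>p. (\<integral>x. \<Theta> x p \<partial>lborel) \<partial>(lborel \<Otimes>\<^sub>M lborel))"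
    by (rule lborel_triple.Fubini_integral[OF \<Theta>_int', symmetric])
  also have "\<dots> = (\<integral>p. M p * (g (fst p) * cnj (g (snd p))) \<partial>(lborel \<Otimes>\<^sub>M lborel))"
    unfolding \<Theta>_def M_def by (simp only: integral_mult_left_zero)
  finally have eq: "of_real (\<integral>x. E x * (norm (heat_conv w g x))\<^sup>2 \<partial>lborel) = (\<integral>p. M p * (g (fst p) * cnj (g (snd p))) \<partial>(lborel \<Otimes>\<^sub>M lborel))" .
  have M[measurable]: "M \<in> borel_measurable (lborel \<Otimes>\<^sub>M lborel)"
    unfolding M_def by measurable
  define c where "c = (pi / s) ^ DIM('a) * sqrt (1 / (3 * pi * a)) ^ DIM('a)"
  have c0: "c \<ge> 0" using s a by (simp add: c_def)
  have M_le: "norm (M (z, z')) \<le> c * (exp (- (pi\<^sup>2 / 3 * a) * (norm z)\<^sup>2) * exp (- (pi\<^sup>2 / 3) * (norm (z' - z))\<^sup>2))" for z z'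
  proof -
    have "- (pi\<^sup>2 / 3) * (a * ((norm z)\<^sup>2 + (norm z')\<^sup>2) + (norm (z - z'))\<^sup>2)
        \<le> - (pi\<^sup>2 / 3 * a) * (norm z)\<^sup>2 + - (pi\<^sup>2 / 3) * (norm (z' - z))\<^sup>2"
      using a by (simp add: algebra_simps norm_minus_commute)
    then show ?thesis
      using norm_heat_gram[OF w, of z z'] c0
      unfolding M_def E_def a_def s_def c_def
      by (auto simp flip: exp_add intro!: mult_left_mono)
  qed
  have "ennreal (\<integral>x. E x * (norm (heat_conv w g x))\<^sup>2 \<partial>lborel) \<le> ennreal (norm (complex_of_real (\<integral>x. E x * (norm (heat_conv w g x))\<^sup>2 \<partial>lborel)))"
    unfolding norm_of_real by (intro ennreal_leI abs_ge_self)
  also have "\<dots> \<le> (\<integral>\<^sup>+p. norm (M p * (g (fst p) * cnj (g (snd p)))) \<partial>(lborel \<Otimes>\<^sub>M lborel))"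
    unfolding eq
  proof (rule integral_norm_bound_ennreal)
    have "integrable (lborel \<Otimes>\<^sub>M lborel) (\<lambda>p. \<integral>x. \<Theta> x p \<partial>lborel)"
      by (rule lborel_triple.integrable_snd[OF \<Theta>_int'])
    then show "integrable (lborel \<Otimes>\<^sub>M lborel) (\<lambda>p. M p * (g (fst p) * cnj (g (snd p))))"
      unfolding \<Theta>_def M_def by (simp only: integral_mult_left_zero)
  qed
  also have "\<dots> = (\<integral>\<^sup>+z. (\<integral>\<^sup>+z'. norm (M (z, z') * (g z * cnj (g z'))) \<partial>lborel) \<partial>lborel)"
    by (subst lborel.nn_integral_fst[symmetric]) auto
  also have "\<dots> \<le> (\<integral>\<^sup>+z. (\<integral>\<^sup>+z'. ennreal (G\<^sup>2 * c * exp (- (pi\<^sup>2 / 3 * a) * (norm (z::'a))\<^sup>2)) *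
      ennreal (exp (- (pi\<^sup>2 / 3) * (norm (z' - z))\<^sup>2)) \<partial>lborel) \<partial>lborel)"
  proof (rule nn_integral_mono_AE, rule AE_mp[OF G], intro AE_I2 impI)
    fix z assume z: "norm (g z) \<le> G"
    show "(\<integral>\<^sup>+z'. norm (M (z, z') * (g z * cnj (g z'))) \<partial>lborel)
       \<le> (\<integral>\<^sup>+z'. ennreal (G\<^sup>2 * c * exp (- (pi\<^sup>2 / 3 * a) * (norm z)\<^sup>2)) *
      ennreal (exp (- (pi\<^sup>2 / 3) * (norm (z' - z))\<^sup>2)) \<partial>lborel)"
    proof (rule nn_integral_mono_AE, rule AE_mp[OF G], intro AE_I2 impI)
      fix z' assume z': "norm (g z') \<le> G"
      have "norm (M (z, z') * (g z * cnj (g z')))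
        \<le> c * (exp (- (pi\<^sup>2 / 3 * a) * (norm z)\<^sup>2) * exp (- (pi\<^sup>2 / 3) * (norm (z' - z))\<^sup>2)) * (G * G)"
        unfolding norm_mult complex_mod_cnj using M_le[of z z'] z z' G0 c0 by (intro mult_mono) auto
      then show "ennreal (norm (M (z, z') * (g z * cnj (g z'))))
        \<le> ennreal (G\<^sup>2 * c * exp (- (pi\<^sup>2 / 3 * a) * (norm z)\<^sup>2)) * ennreal (exp (- (pi\<^sup>2 / 3) * (norm (z' - z))\<^sup>2))"
        using c0 G0 by (subst ennreal_mult[symmetric]) (auto intro!: ennreal_leI simp: power2_eq_square mult_ac)
    qed
  qed
  also have "\<dots> = (\<integral>\<^sup>+z. ennreal (G\<^sup>2 * c) * ennreal (exp (- (pi\<^sup>2 / 3 * a) * (norm (z::'a))\<^sup>2)) * ennreal (sqrt (3 / pi) ^ DIM('a)) \<partial>lborel)"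
  proof (intro nn_integral_cong)
    fix z :: 'a
    have "(\<integral>\<^sup>+z'. ennreal (exp (- (pi\<^sup>2 / 3) * (norm (z' - z))\<^sup>2)) \<partial>lborel) = ennreal (sqrt (3 / pi) ^ DIM('a))"
      using nn_integral_lborel_shift[of "\<lambda>z'. ennreal (exp (- (pi\<^sup>2 / 3) * (norm (z'::'a))\<^sup>2))" "- z"]
        nn_integral_real_gaussian[of "pi\<^sup>2 / 3", where 'a = 'a]
      by (simp add: power2_eq_square)
    then show "(\<integral>\<^sup>+z'. ennreal (G\<^sup>2 * c * exp (- (pi\<^sup>2 / 3 * a) * (norm z)\<^sup>2)) *
      ennreal (exp (- (pi\<^sup>2 / 3) * (norm (z' - z))\<^sup>2)) \<partial>lborel)
      = ennreal (G\<^sup>2 * c) * ennreal (exp (- (pi\<^sup>2 / 3 * a) * (norm z)\<^sup>2)) * ennreal (sqrt (3 / pi) ^ DIM('a))"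
      using c0 by (subst nn_integral_cmult) (auto simp: ennreal_mult)
  qed
  also have "\<dots> = ennreal (G\<^sup>2 * c) * ennreal (sqrt (3 / (pi * a)) ^ DIM('a)) * ennreal (sqrt (3 / pi) ^ DIM('a))"
    using nn_integral_real_gaussian[of "pi\<^sup>2 / 3 * a", where 'a = 'a] a
    by (simp add: nn_integral_cmult nn_integral_multc power2_eq_square)
  also have "\<dots> = ennreal (G\<^sup>2 * (c * sqrt (3 / (pi * a)) ^ DIM('a) * sqrt (3 / pi) ^ DIM('a)))"
    using c0 a by (simp add: ennreal_mult[symmetric] mult_ac)
  also have "c * sqrt (3 / (pi * a)) ^ DIM('a) * sqrt (3 / pi) ^ DIM('a) = (s * sqrt (3 / pi)) ^ DIM('a)"
  proof -
    have "sqrt (1 / (3 * pi * a)) = s / (sqrt 3 * sqrt pi)"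
      using s by (simp add: a_def real_sqrt_divide real_sqrt_mult)
    moreover have "sqrt (3 / (pi * a)) = s * sqrt 3 / sqrt pi"
      using s by (simp add: a_def real_sqrt_divide real_sqrt_mult)
    moreover have "pi / s * (s / (sqrt 3 * sqrt pi)) * (s * sqrt 3 / sqrt pi) * (sqrt 3 / sqrt pi) = s * (sqrt 3 / sqrt pi)"
      using s by (simp add: field_simps)
    ultimately have "pi / s * sqrt (1 / (3 * pi * a)) * sqrt (3 / (pi * a)) * sqrt (3 / pi) = s * sqrt (3 / pi)"
      by (simp only: real_sqrt_divide)
    then show ?thesis
      unfolding c_def power_mult_distrib[symmetric] by simp
  qed
  also have "ennreal (G\<^sup>2 * (s * sqrt (3 / pi)) ^ DIM('a)) \<le> ennreal (G\<^sup>2 * s ^ DIM('a))"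
    using s pi_gt3 by (intro ennreal_leI mult_left_mono power_mono mult_right_le_one_le) auto
  finally show ?thesis
    using int unfolding s_def[symmetric]
    by (subst nn_integral_eq_integral) (auto simp: E_def a_def)
qed

lemma heat_mult_heat_conv_le:
  fixes g :: "'a::euclidean_space \<Rightarrow> complex"
  assumes w: "Re w = 1" and g: "integrable lborel g"
    and G: "AE x in lborel. norm (g x) \<le> G" and G0: "G > 0"
  shows "(\<integral>\<^sup>+x. ennreal (norm (heat w x) * norm (heat_conv w g x)) \<partial>lborel)
    \<le> ennreal (sqrt (pi * norm w) ^ DIM('a) * G)"
proof -
  have [measurable]: "g \<in> borel_measurable borel" using g by auto
  have "w \<noteq> 0" using w by auto
  define s where "s = norm w"
  then have s: "s > 0" using \<open>w \<noteq> 0\<close> by simp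
  define E where "E = (\<lambda>x::'a. exp (- (pi\<^sup>2 / s\<^sup>2) * (norm x)\<^sup>2))"
  define B where "B = sqrt (pi / s) ^ DIM('a)"
  have B0: "B \<ge> 0" using s by (simp add: B_def)
  have [measurable]: "E \<in> borel_measurable borel" unfolding E_def by measurable
  have "(\<integral>\<^sup>+x. ennreal (norm (heat w x) * norm (heat_conv w g x)) \<partial>lborel)
    \<le> (\<integral>\<^sup>+x. ennreal (B * G / 2) * ennreal (E x) + ennreal (B / (2 * G)) * ennreal (E x * (norm (heat_conv w g x))\<^sup>2) \<partial>lborel)"
  proof (intro nn_integral_mono)
    fix x :: 'a
    define y where "y = norm (heat_conv w g x)"
    have "2 * y \<le> G + y\<^sup>2 / G"
      using sum_squares_bound[of y G] G0 by (simp add: field_simps power2_eq_square)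
    then have "B / 2 * E x * (2 * y) \<le> B / 2 * E x * (G + y\<^sup>2 / G)"
      using B0 by (intro mult_left_mono) (auto simp: E_def)
    then have "B * E x * y \<le> B * G / 2 * E x + B / (2 * G) * (E x * y\<^sup>2)"
      by (simp add: algebra_simps)
    then have "norm (heat w x) * y \<le> B * G / 2 * E x + B / (2 * G) * (E x * y\<^sup>2)"
      by (simp add: norm_heat[OF w] B_def E_def s_def)
    then show "ennreal (norm (heat w x) * norm (heat_conv w g x))
       \<le> ennreal (B * G / 2) * ennreal (E x) + ennreal (B / (2 * G)) * ennreal (E x * (norm (heat_conv w g x))\<^sup>2)"
      using B0 G0 unfolding y_def[symmetric]
      by (simp add: E_def ennreal_leI flip: ennreal_mult ennreal_plus)
  qed
  also have "\<dots> = ennreal (B * G / 2) * (\<integral>\<^sup>+x. ennreal (E x) \<partial>lborel)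
      + ennreal (B / (2 * G)) * (\<integral>\<^sup>+x. ennreal (E x * (norm (heat_conv w g x))\<^sup>2) \<partial>lborel)"
    by (simp add: nn_integral_add nn_integral_cmult)
  also have "\<dots> \<le> ennreal (B * G / 2) * ennreal (s ^ DIM('a)) + ennreal (B / (2 * G)) * ennreal (G\<^sup>2 * s ^ DIM('a))"
  proof (intro add_mono mult_left_mono)
    have "(\<integral>\<^sup>+x. ennreal (E x) \<partial>lborel) = ennreal (sqrt (pi / (pi\<^sup>2 / s\<^sup>2)) ^ DIM('a))"
      using nn_integral_real_gaussian[of "pi\<^sup>2 / s\<^sup>2", where 'a = 'a] s unfolding E_def by simp
    also have "sqrt (pi / (pi\<^sup>2 / s\<^sup>2)) \<le> s"
      using s pi_gt3 by (intro real_le_lsqrt) (auto simp: power2_eq_square field_simps)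
    then have "ennreal (sqrt (pi / (pi\<^sup>2 / s\<^sup>2)) ^ DIM('a)) \<le> ennreal (s ^ DIM('a))"
      using s by (intro ennreal_leI power_mono) auto
    finally show "(\<integral>\<^sup>+x. ennreal (E x) \<partial>lborel) \<le> ennreal (s ^ DIM('a))" .
    show "(\<integral>\<^sup>+x. ennreal (E x * (norm (heat_conv w g x))\<^sup>2) \<partial>lborel) \<le> ennreal (G\<^sup>2 * s ^ DIM('a))"
      using heat_conv_weighted_L2[OF w g G G0] unfolding E_def s_def by simp
  qed auto
  also have "\<dots> = ennreal (B * s ^ DIM('a) * G)"
    using B0 G0 s by (simp add: field_simps power2_eq_square flip: ennreal_mult ennreal_plus)
  also have "B * s ^ DIM('a) = sqrt (pi * s) ^ DIM('a)"
  proof -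
    have "sqrt (pi / s) * s = sqrt (pi * s)"
      using s by (simp add: real_sqrt_divide real_sqrt_mult field_simps)
    then show ?thesis
      unfolding B_def power_mult_distrib[symmetric] by simp
  qed
  finally show ?thesis
    unfolding s_def .
qed

section \<open>Fourier inversion for the Gamma density\<close>

lemma integrable_sqrt_powr:
  assumes q: "q > 1"
  shows "integrable lborel (\<lambda>t. sqrt (1 + t\<^sup>2) powr (- q))"
proof (rule integrableI_bounded)
  define f where "f = (\<lambda>t::real. ennreal ((1 + \<bar>t\<bar>) powr (- q)) * indicator {0..} t)"
  have [measurable]: "f \<in> borel_measurable borel" unfolding f_def by measurable
  have f: "(\<integral>\<^sup>+t. f t \<partial>lborel) < \<infinity>"
  proof -
    have "(\<integral>\<^sup>+t. f t \<partial>lborel) = (\<integral>\<^sup>+t. ennreal ((1 + t) powr (- q)) * indicator {0..} t \<partial>lborel)"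
      unfolding f_def by (intro nn_integral_cong) (auto split: split_indicator)
    also have "\<dots> = ennreal (0 - (1 + 0) powr (1 - q) / (1 - q))"
    proof (rule nn_integral_FTC_atLeast)
      show "((\<lambda>t. (1 + t) powr (1 - q) / (1 - q)) has_real_derivative (1 + x) powr (- q)) (at x)" if "0 \<le> x" for x
        using that q by (auto intro!: derivative_eq_intros)
      show "((\<lambda>t. (1 + t) powr (1 - q) / (1 - q)) \<longlongrightarrow> 0) at_top"
        using q by real_asymp
    qed auto
    finally show ?thesis by simp
  qed
  have le: "sqrt (1 + t\<^sup>2) powr (- q) \<le> 2 powr q * (1 + \<bar>t\<bar>) powr (- q)" for t
  proof -
    have "1 + \<bar>t\<bar> \<le> 2 * sqrt (1 + t\<^sup>2)"
      using real_le_rsqrt[of "\<bar>t\<bar>" "1 + t\<^sup>2"] real_sqrt_ge_1_iff[of "1 + t\<^sup>2"] by (simp del: real_sqrt_ge_1_iff)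
    then have "(2 * sqrt (1 + t\<^sup>2)) powr (- q) \<le> (1 + \<bar>t\<bar>) powr (- q)"
      using q by (intro powr_mono2') auto
    then have "2 powr q * (2 * sqrt (1 + t\<^sup>2)) powr (- q) \<le> 2 powr q * (1 + \<bar>t\<bar>) powr (- q)"
      by (intro mult_left_mono) auto
    moreover have "2 powr q * (2 * sqrt (1 + t\<^sup>2)) powr (- q) = sqrt (1 + t\<^sup>2) powr (- q)"
      by (simp add: powr_mult powr_minus)
    ultimately show ?thesis by simp
  qed
  have "(\<integral>\<^sup>+t. ennreal (norm (sqrt (1 + t\<^sup>2) powr (- q))) \<partial>lborel) \<le> (\<integral>\<^sup>+t. ennreal (2 powr q) * (f t + f (0 + (- 1) * t)) \<partial>lborel)"
  proof (intro nn_integral_mono)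
    fix t :: real
    have "ennreal (norm (sqrt (1 + t\<^sup>2) powr (- q))) \<le> ennreal (2 powr q) * ennreal ((1 + \<bar>t\<bar>) powr (- q))"
      using le[of t] by (simp add: ennreal_leI flip: ennreal_mult)
    also have "\<dots> \<le> ennreal (2 powr q) * (f t + f (0 + (- 1) * t))"
      by (intro mult_left_mono) (auto simp: f_def split: split_indicator)
    finally show "ennreal (norm (sqrt (1 + t\<^sup>2) powr (- q))) \<le> ennreal (2 powr q) * (f t + f (0 + (- 1) * t))" .
  qed
  also have "\<dots> = ennreal (2 powr q) * ((\<integral>\<^sup>+t. f t \<partial>lborel) + (\<integral>\<^sup>+t. f t \<partial>lborel))"
    using nn_integral_real_affine[of f "-1" 0] by (simp add: nn_integral_cmult nn_integral_add)
  also have "\<dots> < \<infinity>"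
    using f by (simp add: ennreal_mult_less_top)
  finally show "(\<integral>\<^sup>+t. ennreal (norm (sqrt (1 + t\<^sup>2) powr (- q))) \<partial>lborel) < \<infinity>" .
qed measurable

definition gamma_weight :: "real \<Rightarrow> real \<Rightarrow> real" where
  "gamma_weight \<delta> s = max 0 s powr \<delta> * exp (- s)"

definition gamma_fourier :: "real \<Rightarrow> real \<Rightarrow> complex" where
  "gamma_fourier \<delta> t = (\<integral>s. of_real (gamma_weight \<delta> s) * exp (- \<i> * of_real (t * s)) \<partial>lborel)"

lemma borel_measurable_gamma_weight [measurable]: "gamma_weight \<delta> \<in> borel_measurable borel"
  unfolding gamma_weight_def by measurable

lemma gamma_weight_nonneg: "gamma_weight \<delta> s \<ge> 0"
  by (simp add: gamma_weight_def)

lemma integrable_gamma_weight: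
  assumes "\<delta> > 0"
  shows "integrable lborel (gamma_weight \<delta>)"
proof (rule integrableI_nn_integral_finite)
  have "(\<integral>\<^sup>+s. ennreal (gamma_weight \<delta> s) \<partial>lborel)
      = (\<integral>\<^sup>+t. ennreal (indicat_real {0..} t * t powr (\<delta> + 1 - 1) / exp t) \<partial>lborel)"
    by (intro nn_integral_cong) (auto simp: gamma_weight_def exp_minus field_simps max_def split: split_indicator)
  also have "\<dots> = ennreal (Gamma (\<delta> + 1))"
    using Gamma_conv_nn_integral_real[of "\<delta> + 1"] assms by simp
  finally show "(\<integral>\<^sup>+s. ennreal (gamma_weight \<delta> s) \<partial>lborel) = ennreal (Gamma (\<delta> + 1))" .
qed (use assms in \<open>auto simp: gamma_weight_nonneg Gamma_real_nonneg\<close>)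

lemma continuous_on_gamma_weight:
  assumes "\<delta> > 0"
  shows "continuous_on A (gamma_weight \<delta>)"
  unfolding gamma_weight_def using assms by (intro continuous_intros continuous_on_powr') auto

lemma gamma_weight_bounded:
  assumes "\<delta> > 0"
  shows "gamma_weight \<delta> s \<le> \<delta> powr \<delta>"
proof (cases "s > 0")
  case True
  have "\<delta> * ln (s / \<delta>) \<le> \<delta> * (s / \<delta> - 1)"
    using True assms by (intro mult_left_mono ln_le_minus_one) auto
  then have "\<delta> * ln s - s \<le> \<delta> * ln \<delta>"
    using True assms by (simp add: ln_div algebra_simps)
  then show ?thesis
    using True assms by (simp add: gamma_weight_def powr_def max_def flip: exp_add)
qed (auto simp: gamma_weight_def max_def)

lemma integrable_gamma_fourier:
  assumes "\<delta> > 0"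
  shows "integrable lborel (\<lambda>s. of_real (gamma_weight \<delta> s) * exp (- \<i> * of_real (t * s)))"
proof (rule Bochner_Integration.integrable_bound[OF integrable_gamma_weight[OF assms]])
  show "AE s in lborel. norm (of_real (gamma_weight \<delta> s) * exp (- \<i> * of_real (t * s))) \<le> norm (gamma_weight \<delta> s)"
    by (simp add: norm_mult)
qed measurable

lemma gamma_fourier_recurrence:
  assumes \<delta>: "\<delta> > 0"
  shows "(1 + \<i> * of_real t) * gamma_fourier (\<delta> + 1) t = of_real (\<delta> + 1) * gamma_fourier \<delta> t"
proof -
  define e where "e = (\<lambda>s. exp (- (1 + \<i> * of_real t) * of_real s))"
  define F where "F = (\<lambda>s. of_real (s powr (\<delta> + 1)) * e s)"
  define f where "f = (\<lambda>s. of_real ((\<delta> + 1) * s powr \<delta>) * e s - (1 + \<i> * of_real t) * F s)"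
  have w: "of_real (gamma_weight p s) * exp (- \<i> * of_real (t * s)) = (if s > 0 then of_real (s powr p) * e s else 0)" for p s
    by (simp add: gamma_weight_def e_def max_def exp_of_real[symmetric] algebra_simps flip: exp_add)
  have f_eq: "indicat_real {0<..} s *\<^sub>R f s = of_real (\<delta> + 1) * (of_real (gamma_weight \<delta> s) * exp (- \<i> * of_real (t * s)))
      - (1 + \<i> * of_real t) * (of_real (gamma_weight (\<delta> + 1) s) * exp (- \<i> * of_real (t * s)))" for s
    unfolding w by (simp add: f_def F_def split: split_indicator)
  note int = integrable_gamma_fourier[OF \<delta>, of t] integrable_gamma_fourier[of "\<delta> + 1" t]
  have norm_F: "norm (F s) = s powr (\<delta> + 1) * exp (- s)" for s
    by (simp add: F_def e_def norm_mult)
  have "(LBINT s=0..\<infinity>. f s) = 0 - 0"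
  proof (rule interval_integral_FTC_integrable)
    fix s :: real assume "0 < ereal s"
    then have s: "s > 0" by simp
    have e': "(e has_vector_derivative - (1 + \<i> * of_real t) * e s) (at s)"
      unfolding e_def by (rule has_vector_derivative_real_field) (auto intro!: derivative_eq_intros)
    have "((\<lambda>s. s powr (\<delta> + 1)) has_real_derivative (\<delta> + 1) * s powr \<delta>) (at s)"
      using s by (auto intro!: derivative_eq_intros)
    then have "((\<lambda>s. complex_of_real (s powr (\<delta> + 1))) has_vector_derivative of_real ((\<delta> + 1) * s powr \<delta>)) (at s)"
      by (rule has_vector_derivative_of_real)
    from has_vector_derivative_mult[OF this e']
    show "(F has_vector_derivative f s) (at s)"
      unfolding F_def f_def by (simp add: algebra_simps)
    show "isCont f s"
      unfolding f_def F_def e_def using s by (intro continuous_intros) auto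
  next
    show "set_integrable lborel (einterval 0 \<infinity>) f"
      unfolding set_integrable_def using int \<delta>
      by (simp add: f_eq einterval_def greaterThan_def[symmetric] zero_ereal_def)
    have "((\<lambda>s. s powr (\<delta> + 1) * exp (- s)) \<longlongrightarrow> 0) (at_right 0)"
      using \<delta> by real_asymp
    then have "(F \<longlongrightarrow> 0) (at_right 0)"
      unfolding norm_F[symmetric] by (rule tendsto_norm_zero_cancel)
    then show "((F \<circ> real_of_ereal) \<longlongrightarrow> 0) (at_right 0)"
      by (simp add: zero_ereal_def ereal_tendsto_simps)
    have "((\<lambda>s. s powr (\<delta> + 1) * exp (- s)) \<longlongrightarrow> 0) at_top"
      using \<delta> by real_asymp
    then have "(F \<longlongrightarrow> 0) at_top"
      unfolding norm_F[symmetric] by (rule tendsto_norm_zero_cancel)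
    then show "((F \<circ> real_of_ereal) \<longlongrightarrow> 0) (at_left \<infinity>)"
      by (simp add: ereal_tendsto_simps)
  qed auto
  then have "(\<integral>s. indicat_real {0<..} s *\<^sub>R f s \<partial>lborel) = 0"
    by (simp add: interval_lebesgue_integral_def set_lebesgue_integral_def einterval_def greaterThan_def[symmetric] zero_ereal_def)
  then show ?thesis
    unfolding f_eq gamma_fourier_def using int \<delta> by simp
qed

lemma norm_gamma_fourier:
  assumes \<delta>: "\<delta> > 0"
  shows "norm (gamma_fourier \<delta> t) = norm (gamma_fourier \<delta> 0) * sqrt (1 + t\<^sup>2) powr (- (\<delta> + 1))"
proof -
  define \<phi> where "\<phi> = gamma_fourier \<delta>"
  have \<phi>': "(\<phi> has_vector_derivative - \<i> * of_real (\<delta> + 1) / (1 + \<i> * of_real t) * \<phi> t) (at t)" for t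
  proof -
    have "(gamma_fourier \<delta> has_vector_derivative (\<integral>s. - \<i> * (of_real (gamma_weight (\<delta> + 1) s) * exp (- \<i> * of_real (t * s))) \<partial>lborel)) (at t)"
      unfolding gamma_fourier_def
    proof (rule has_vector_derivative_integral[where T = UNIV and g = "gamma_weight (\<delta> + 1)"])
      fix u s :: real
      have "gamma_weight (\<delta> + 1) s = s * gamma_weight \<delta> s"
        by (cases "s > 0") (auto simp: gamma_weight_def max_def powr_add)
      then have "((\<lambda>z. of_real (gamma_weight \<delta> s) * exp (- \<i> * (z * of_real s))) has_field_derivative
          - \<i> * (of_real (gamma_weight (\<delta> + 1) s) * exp (- \<i> * of_real (u * s)))) (at (of_real u))"
        by (auto intro!: derivative_eq_intros)
      from has_vector_derivative_real_field[OF this]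
      show "((\<lambda>t. of_real (gamma_weight \<delta> s) * exp (- \<i> * of_real (t * s))) has_vector_derivative
          - \<i> * (of_real (gamma_weight (\<delta> + 1) s) * exp (- \<i> * of_real (u * s)))) (at u)"
        by (simp only: of_real_mult)
      show "integrable lborel (\<lambda>s. of_real (gamma_weight \<delta> s) * exp (- \<i> * of_real (u * s)))"
        by (rule integrable_gamma_fourier[OF \<delta>])
      show "norm (- \<i> * (of_real (gamma_weight (\<delta> + 1) s) * exp (- \<i> * of_real (u * s)))) \<le> gamma_weight (\<delta> + 1) s"
        by (simp add: norm_mult gamma_weight_nonneg)
    qed (use \<delta> integrable_gamma_weight[of "\<delta> + 1"] in auto)
    also have "(\<integral>s. - \<i> * (of_real (gamma_weight (\<delta> + 1) s) * exp (- \<i> * of_real (t * s))) \<partial>lborel) = - \<i> * gamma_fourier (\<delta> + 1) t"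
      unfolding gamma_fourier_def by (rule integral_mult_right_zero)
    also have "\<dots> = - \<i> * of_real (\<delta> + 1) / (1 + \<i> * of_real t) * \<phi> t"
    proof -
      have "1 + \<i> * of_real t \<noteq> 0" by (simp add: complex_eq_iff)
      then show ?thesis
        using gamma_fourier_recurrence[OF \<delta>, of t] by (simp add: \<phi>_def field_simps)
    qed
    finally show ?thesis unfolding \<phi>_def .
  qed
  define K where "K = (\<lambda>t. Re (\<phi> t * cnj (\<phi> t)) * (1 + t\<^sup>2) powr (\<delta> + 1))"
  have "(K has_vector_derivative 0) (at t)" for t
  proof -
    have p: "1 + t\<^sup>2 > 0" by (simp add: add_pos_nonneg)
    define d where "d = - \<i> * of_real (\<delta> + 1) / (1 + \<i> * of_real t)"
    have d: "Re d = - ((\<delta> + 1) * t / (1 + t\<^sup>2))"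
      by (simp add: d_def Re_divide power2_eq_square)
    have "((\<lambda>t. Re (\<phi> t * cnj (\<phi> t))) has_vector_derivative Re (\<phi> t * cnj (d * \<phi> t) + d * \<phi> t * cnj (\<phi> t))) (at t)"
      using \<phi>'[of t] unfolding d_def[symmetric]
      by (intro bounded_linear.has_vector_derivative[OF bounded_linear_Re] has_vector_derivative_mult
          bounded_linear.has_vector_derivative[OF bounded_linear_cnj])
    also have "Re (\<phi> t * cnj (d * \<phi> t) + d * \<phi> t * cnj (\<phi> t)) = 2 * Re d * Re (\<phi> t * cnj (\<phi> t))"
      by (simp add: algebra_simps)
    finally have 1: "((\<lambda>t. Re (\<phi> t * cnj (\<phi> t))) has_real_derivative 2 * Re d * Re (\<phi> t * cnj (\<phi> t))) (at t)"
      unfolding has_real_derivative_iff_has_vector_derivative .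
    have 2: "((\<lambda>t. (1 + t\<^sup>2) powr (\<delta> + 1)) has_real_derivative (\<delta> + 1) * (1 + t\<^sup>2) powr \<delta> * (2 * t)) (at t)"
      using p by (auto intro!: derivative_eq_intros)
    have 3: "(1 + t\<^sup>2) powr (\<delta> + 1) = (1 + t\<^sup>2) powr \<delta> * (1 + t\<^sup>2)"
      using p by (simp add: powr_add)
    show ?thesis
      unfolding K_def has_real_derivative_iff_has_vector_derivative[symmetric]
      by (rule DERIV_cong[OF DERIV_mult[OF 1 2]]) (unfold d 3, use p in \<open>simp add: field_simps\<close>)
  qed
  then obtain c where "\<And>t. K t = c"
    using has_vector_derivative_zero_constant[of UNIV K] by auto
  then have "K t = K 0" by simp
  then have "(norm (\<phi> t))\<^sup>2 * (1 + t\<^sup>2) powr (\<delta> + 1) = (norm (\<phi> 0))\<^sup>2"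
    unfolding K_def complex_norm_square[symmetric] by simp
  moreover have "(sqrt (1 + t\<^sup>2) powr (\<delta> + 1))\<^sup>2 = (1 + t\<^sup>2) powr (\<delta> + 1)"
    unfolding power2_eq_square[of "_ powr _"] powr_mult[symmetric] by simp
  ultimately have "(norm (\<phi> t) * sqrt (1 + t\<^sup>2) powr (\<delta> + 1))\<^sup>2 = (norm (\<phi> 0))\<^sup>2"
    by (simp add: power_mult_distrib)
  then have "norm (\<phi> t) * sqrt (1 + t\<^sup>2) powr (\<delta> + 1) = norm (\<phi> 0)"
    by (rule power2_eq_imp_eq) auto
  moreover have "sqrt (1 + t\<^sup>2) powr (\<delta> + 1) > 0"
    using add_pos_nonneg[of 1 "t\<^sup>2"] by simp
  ultimately show ?thesis
    unfolding \<phi>_def powr_minus by (simp add: field_simps)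
qed

lemma borel_measurable_gamma_fourier [measurable]: "gamma_fourier \<delta> \<in> borel_measurable borel"
  unfolding gamma_fourier_def by measurable

lemma integrable_gamma_fourier_powr:
  assumes "\<delta> > 0" "p < \<delta>"
  shows "integrable lborel (\<lambda>t. norm (gamma_fourier \<delta> t) * sqrt (1 + t\<^sup>2) powr p)"
proof -
  have "norm (gamma_fourier \<delta> t) * sqrt (1 + t\<^sup>2) powr p = norm (gamma_fourier \<delta> 0) * sqrt (1 + t\<^sup>2) powr (- (\<delta> + 1 - p))" for t
    unfolding norm_gamma_fourier[OF assms(1), of t] mult.assoc powr_add[symmetric] by (simp add: algebra_simps)
  then show ?thesis
    using integrable_sqrt_powr[of "\<delta> + 1 - p"] assms by simp
qed

lemma integrable_gamma_fourier_transform: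
  assumes "\<delta> > 0"
  shows "integrable lborel (gamma_fourier \<delta>)"
proof -
  have "sqrt (1 + t\<^sup>2) \<noteq> 0" for t :: real
    using add_pos_nonneg[of 1 "t\<^sup>2"] by simp
  then have "integrable lborel (\<lambda>t. norm (gamma_fourier \<delta> t))"
    using integrable_gamma_fourier_powr[of \<delta> 0] assms by simp
  then show ?thesis
    by (rule integrable_norm_cancel) measurable
qed

lemma integral_cgauss_imaginary:
  assumes "h > 0"
  shows "(\<integral>t. cgauss (of_real (h\<^sup>2)) (\<i> * of_real y) t \<partial>lborel) = of_real (sqrt pi / h * exp (- y\<^sup>2 / (4 * h\<^sup>2)))"
proof -
  have r: "Re (of_real (h\<^sup>2)) > 0" using assms by simp
  have "(\<integral>t. cgauss (of_real (h\<^sup>2)) 0 t \<partial>lborel) = complex_of_real (sqrt (pi / h\<^sup>2))"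
    using integral_gaussian_real[of "h\<^sup>2"] assms
    by (simp add: cgauss_def exp_of_real flip: of_real_power of_real_mult of_real_minus)
  then show ?thesis
    using assms unfolding integral_cgauss[OF r, of "\<i> * of_real y"]
    by (simp add: real_sqrt_divide power_mult_distrib flip: exp_of_real)
qed

lemma gamma_fourier_gaussian_mean:
  assumes \<delta>: "\<delta> > 0" and h: "h > 0"
  shows "(\<integral>t. gamma_fourier \<delta> t * exp (\<i> * of_real (t * A)) * of_real (exp (- h\<^sup>2 * t\<^sup>2)) \<partial>lborel)
    = of_real (2 * sqrt pi * (\<integral>y. gamma_weight \<delta> (A + 2 * h * y) * exp (- 1 * y\<^sup>2) \<partial>lborel))"
proof -
  define \<Phi> where "\<Phi> = (\<lambda>t s. of_real (gamma_weight \<delta> s) * exp (- \<i> * of_real (t * s)) * exp (\<i> * of_real (t * A)) * of_real (exp (- h\<^sup>2 * t\<^sup>2)))"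
  have int: "integrable (lborel \<Otimes>\<^sub>M lborel) (\<lambda>(t, s). \<Phi> t s)"
  proof (rule Bochner_Integration.integrable_bound)
    have "integrable lborel (\<lambda>t::real. exp (- h\<^sup>2 * t\<^sup>2))"
      using integrable_power_gaussian[of "h\<^sup>2" 0] h by simp
    then show "integrable (lborel \<Otimes>\<^sub>M lborel) (\<lambda>p::real \<times> real. exp (- h\<^sup>2 * (fst p)\<^sup>2) * gamma_weight \<delta> (snd p))"
      by (rule lborel_pair.integrable_mult_pair[OF _ integrable_gamma_weight[OF \<delta>]])
    show "AE p in lborel \<Otimes>\<^sub>M lborel. norm (case p of (t, s) \<Rightarrow> \<Phi> t s) \<le> norm (exp (- h\<^sup>2 * (fst p)\<^sup>2) * gamma_weight \<delta> (snd p))"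
      by (intro AE_I2) (auto simp: \<Phi>_def norm_mult abs_mult mult.commute split: prod.split)
    show "(\<lambda>(t, s). \<Phi> t s) \<in> borel_measurable (lborel \<Otimes>\<^sub>M lborel)"
      unfolding \<Phi>_def by measurable
  qed
  have "(\<integral>t. gamma_fourier \<delta> t * exp (\<i> * of_real (t * A)) * of_real (exp (- h\<^sup>2 * t\<^sup>2)) \<partial>lborel) = (\<integral>t. (\<integral>s. \<Phi> t s \<partial>lborel) \<partial>lborel)"
    unfolding \<Phi>_def gamma_fourier_def by (simp only: integral_mult_left_zero)
  also have "\<dots> = (\<integral>s. (\<integral>t. \<Phi> t s \<partial>lborel) \<partial>lborel)"
    by (rule lborel_pair.Fubini_integral[OF int, symmetric])
  also have "\<dots> = (\<integral>s. of_real (gamma_weight \<delta> s * (sqrt pi / h * exp (- (A - s)\<^sup>2 / (4 * h\<^sup>2)))) \<partial>lborel)"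
  proof (intro Bochner_Integration.integral_cong refl)
    fix s
    have "\<Phi> t s = of_real (gamma_weight \<delta> s) * cgauss (of_real (h\<^sup>2)) (\<i> * of_real (A - s)) t" for t
      unfolding \<Phi>_def cgauss_def exp_of_real[symmetric] mult.assoc exp_add[symmetric]
      by (simp add: algebra_simps)
    then show "(\<integral>t. \<Phi> t s \<partial>lborel) = of_real (gamma_weight \<delta> s * (sqrt pi / h * exp (- (A - s)\<^sup>2 / (4 * h\<^sup>2))))"
      using integral_cgauss_imaginary[OF h, of "A - s"] by simp
  qed
  also have "\<dots> = of_real (\<integral>s. gamma_weight \<delta> s * (sqrt pi / h * exp (- (A - s)\<^sup>2 / (4 * h\<^sup>2))) \<partial>lborel)"
    by (rule integral_complex_of_real)
  also have "(\<integral>s. gamma_weight \<delta> s * (sqrt pi / h * exp (- (A - s)\<^sup>2 / (4 * h\<^sup>2))) \<partial>lborel)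
      = \<bar>2 * h\<bar> *\<^sub>R (\<integral>y. gamma_weight \<delta> (A + 2 * h * y) * (sqrt pi / h * exp (- (A - (A + 2 * h * y))\<^sup>2 / (4 * h\<^sup>2))) \<partial>lborel)"
    using h by (subst lborel_integral_real_affine[of "2 * h" _ A]) auto
  also have "(\<integral>y. gamma_weight \<delta> (A + 2 * h * y) * (sqrt pi / h * exp (- (A - (A + 2 * h * y))\<^sup>2 / (4 * h\<^sup>2))) \<partial>lborel)
      = (\<integral>y. (sqrt pi / h) * (gamma_weight \<delta> (A + 2 * h * y) * exp (- 1 * y\<^sup>2)) \<partial>lborel)"
    using h by (intro Bochner_Integration.integral_cong refl) (simp add: power_mult_distrib field_simps)
  also have "\<dots> = (sqrt pi / h) * (\<integral>y. gamma_weight \<delta> (A + 2 * h * y) * exp (- 1 * y\<^sup>2) \<partial>lborel)"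
    by (rule integral_mult_right_zero)
  finally show ?thesis
    using h by simp
qed

lemma gamma_fourier_inversion:
  assumes \<delta>: "\<delta> > 0"
  shows "(\<integral>t. gamma_fourier \<delta> t * exp (\<i> * of_real (t * A)) \<partial>lborel) = of_real (2 * pi * gamma_weight \<delta> A)"
proof -
  define h where "h = (\<lambda>k. 1 / real (Suc k))"
  have h: "h k > 0" for k by (simp add: h_def)
  have h0: "h \<longlonglongrightarrow> 0" unfolding h_def by (rule LIMSEQ_Suc) (rule lim_1_over_n)
  have gi: "integrable lborel (\<lambda>y::real. exp (- 1 * y\<^sup>2))"
    using integrable_power_gaussian[of 1 0] by simp
  have "(\<lambda>k. \<integral>t. gamma_fourier \<delta> t * exp (\<i> * of_real (t * A)) * of_real (exp (- (h k)\<^sup>2 * t\<^sup>2)) \<partial>lborel)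
      \<longlonglongrightarrow> (\<integral>t. gamma_fourier \<delta> t * exp (\<i> * of_real (t * A)) \<partial>lborel)"
  proof (rule integral_dominated_convergence[where w = "\<lambda>t. norm (gamma_fourier \<delta> t)"])
    show "AE t in lborel. (\<lambda>k. gamma_fourier \<delta> t * exp (\<i> * of_real (t * A)) * of_real (exp (- (h k)\<^sup>2 * t\<^sup>2)))
        \<longlonglongrightarrow> gamma_fourier \<delta> t * exp (\<i> * of_real (t * A))"
    proof (intro AE_I2)
      fix t
      have "(\<lambda>k. gamma_fourier \<delta> t * exp (\<i> * of_real (t * A)) * of_real (exp (- (h k)\<^sup>2 * t\<^sup>2)))
        \<longlonglongrightarrow> gamma_fourier \<delta> t * exp (\<i> * of_real (t * A)) * of_real (exp (- 0\<^sup>2 * t\<^sup>2))"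
        by (intro tendsto_intros h0)
      then show "(\<lambda>k. gamma_fourier \<delta> t * exp (\<i> * of_real (t * A)) * of_real (exp (- (h k)\<^sup>2 * t\<^sup>2)))
        \<longlonglongrightarrow> gamma_fourier \<delta> t * exp (\<i> * of_real (t * A))" by simp
    qed
    show "AE t in lborel. norm (gamma_fourier \<delta> t * exp (\<i> * of_real (t * A)) * of_real (exp (- (h k)\<^sup>2 * t\<^sup>2))) \<le> norm (gamma_fourier \<delta> t)" for k
      by (simp add: norm_mult mult_left_le)
  qed (use integrable_gamma_fourier_transform[OF \<delta>] in auto)
  moreover have "(\<lambda>k. \<integral>y. gamma_weight \<delta> (A + 2 * h k * y) * exp (- 1 * y\<^sup>2) \<partial>lborel) \<longlonglongrightarrow> (\<integral>y. gamma_weight \<delta> A * exp (- 1 * y\<^sup>2) \<partial>lborel)"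
  proof (rule integral_dominated_convergence[where w = "\<lambda>y. \<delta> powr \<delta> * exp (- 1 * y\<^sup>2)"])
    show "AE y in lborel. (\<lambda>k. gamma_weight \<delta> (A + 2 * h k * y) * exp (- 1 * y\<^sup>2)) \<longlonglongrightarrow> gamma_weight \<delta> A * exp (- 1 * y\<^sup>2)"
    proof (intro AE_I2 tendsto_mult tendsto_const)
      fix y
      have "isCont (gamma_weight \<delta>) A"
        using continuous_on_gamma_weight[OF \<delta>, of UNIV] by (simp add: continuous_on_eq_continuous_at)
      moreover have "(\<lambda>k. A + 2 * h k * y) \<longlonglongrightarrow> A + 2 * 0 * y"
        by (intro tendsto_intros h0)
      ultimately show "(\<lambda>k. gamma_weight \<delta> (A + 2 * h k * y)) \<longlonglongrightarrow> gamma_weight \<delta> A"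
        using isCont_tendsto_compose[of A "gamma_weight \<delta>" "\<lambda>k. A + 2 * h k * y" sequentially] by simp
    qed
    show "AE y in lborel. norm (gamma_weight \<delta> (A + 2 * h k * y) * exp (- 1 * y\<^sup>2)) \<le> \<delta> powr \<delta> * exp (- 1 * y\<^sup>2)" for k
      using gamma_weight_bounded[OF \<delta>] gamma_weight_nonneg by (auto simp: abs_mult intro!: mult_right_mono)
  qed (use gi in auto)
  then have "(\<lambda>k. of_real (2 * sqrt pi * (\<integral>y. gamma_weight \<delta> (A + 2 * h k * y) * exp (- 1 * y\<^sup>2) \<partial>lborel)))
      \<longlonglongrightarrow> complex_of_real (2 * sqrt pi * (\<integral>y. gamma_weight \<delta> A * exp (- 1 * y\<^sup>2) \<partial>lborel))"
    by (intro tendsto_intros)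
  ultimately have "(\<integral>t. gamma_fourier \<delta> t * exp (\<i> * of_real (t * A)) \<partial>lborel)
      = of_real (2 * sqrt pi * (\<integral>y. gamma_weight \<delta> A * exp (- 1 * y\<^sup>2) \<partial>lborel))"
    unfolding gamma_fourier_gaussian_mean[OF \<delta> h] by (rule LIMSEQ_unique)
  also have "(\<integral>y. gamma_weight \<delta> A * exp (- 1 * y\<^sup>2) \<partial>lborel) = gamma_weight \<delta> A * sqrt pi"
    unfolding integral_mult_right_zero using integral_gaussian_real[of 1] by simp
  also have "2 * sqrt pi * (gamma_weight \<delta> A * sqrt pi) = 2 * pi * gamma_weight \<delta> A"
    by simp
  finally show ?thesis .
qed

section \<open>Schwartz functions\<close>

lemma schwartz_continuous_on:
  assumes "schwartz f"
  shows "continuous_on A f"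
proof -
  have "\<forall>x. f differentiable (at x)"
    using assms unfolding schwartz_def by (metis empty_set empty_subsetI iterated_partial.simps(1))
  then show ?thesis
    by (meson continuous_at_imp_continuous_on differentiable_imp_continuous_within)
qed

lemma schwartz_decay:
  assumes "schwartz f"
  shows "\<exists>B. \<forall>x. norm x ^ k * norm (f x) \<le> B"
  using assms unfolding schwartz_def by (metis empty_set empty_subsetI iterated_partial.simps(1))

lemma schwartz_integrable:
  fixes f :: "'a::euclidean_space \<Rightarrow> complex"
  assumes f: "schwartz f"
  shows "integrable lborel f"
proof -
  define n where "n = DIM('a)"
  obtain B0 where B0: "\<And>x. norm x ^ 0 * norm (f x) \<le> B0"
    using schwartz_decay[OF f] by blast
  obtain B1 where B1: "\<And>x. norm x ^ (2 * n) * norm (f x) \<le> B1"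
    using schwartz_decay[OF f] by blast
  define q where "q = (\<lambda>x::'a. \<Prod>b\<in>Basis. complex_of_real (sqrt (1 + (x \<bullet> b)\<^sup>2) powr (- 2)))"
  have q_int: "integrable lborel q"
    unfolding q_def
    by (intro integrable_lborel_prod[where f = "\<lambda>_ t. complex_of_real (sqrt (1 + t\<^sup>2) powr (- 2))"] integrable_of_real integrable_sqrt_powr) auto
  have q: "q x = of_real (1 / (\<Prod>b\<in>Basis. 1 + (x \<bullet> b)\<^sup>2))" for x
    unfolding q_def by (simp add: powr_minus prod_inversef[symmetric] divide_inverse add_nonneg_nonneg comp_def)
  show ?thesis
  proof (rule Bochner_Integration.integrable_bound)
    show "integrable lborel (\<lambda>x. of_real (2 ^ n * (B0 + B1)) * q x)"
      using q_int by simp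
    show "f \<in> borel_measurable lborel"
      using borel_measurable_continuous_onI[OF schwartz_continuous_on[OF f]] by simp
    show "AE x in lborel. norm (f x) \<le> norm (of_real (2 ^ n * (B0 + B1)) * q x)"
    proof (rule AE_I2)
      fix x :: 'a
      define P where "P = (\<Prod>b\<in>Basis. 1 + (x \<bullet> b)\<^sup>2)"
      have P: "P > 0" unfolding P_def by (intro prod_pos) (auto intro: add_pos_nonneg)
      have "P \<le> (\<Prod>b\<in>(Basis::'a set). 1 + (norm x)\<^sup>2)"
        unfolding P_def by (rule prod_mono) (simp add: Basis_le_norm flip: abs_le_square_iff)
      also have "\<dots> = (1 + (norm x)\<^sup>2) ^ n" by (simp add: n_def)
      also have "\<dots> \<le> (2 * max 1 ((norm x)\<^sup>2)) ^ n"
        by (intro power_mono) auto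
      also have "\<dots> = 2 ^ n * (max 1 ((norm x)\<^sup>2)) ^ n"
        by (rule power_mult_distrib)
      also have "(max 1 ((norm x)\<^sup>2)) ^ n \<le> 1 + norm x ^ (2 * n)"
        by (cases "1 \<le> (norm x)\<^sup>2") (auto simp: max_def power_mult)
      finally have "P * norm (f x) \<le> 2 ^ n * (1 + norm x ^ (2 * n)) * norm (f x)"
        by (intro mult_right_mono) auto
      also have "\<dots> = 2 ^ n * (norm x ^ 0 * norm (f x) + norm x ^ (2 * n) * norm (f x))"
        by (simp add: algebra_simps)
      also have "\<dots> \<le> 2 ^ n * (B0 + B1)"
        by (intro mult_left_mono add_mono B0 B1) auto
      finally have "norm (f x) \<le> 2 ^ n * (B0 + B1) / P"
        using P by (simp add: field_simps)
      also have "\<dots> \<le> \<bar>2 ^ n * (B0 + B1) / P\<bar>"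
        by (rule abs_ge_self)
      also have "\<dots> = norm (of_real (2 ^ n * (B0 + B1)) * q x)"
        unfolding q P_def[symmetric] norm_mult norm_of_real by (simp add: abs_mult)
      finally show "norm (f x) \<le> norm (of_real (2 ^ n * (B0 + B1)) * q x)" .
    qed
  qed
qed

section \<open>The bilinear Bochner-Riesz operator\<close>

lemma borel_measurable_fourier_transform [measurable]:
  assumes [measurable]: "f \<in> borel_measurable borel"
  shows "fourier_transform f \<in> borel_measurable borel"
  unfolding fourier_transform_def by measurable

lemma norm_exp_imaginary: "norm (exp (2 * of_real pi * \<i> * of_real y)) = 1"
  "norm (exp (- 2 * of_real pi * \<i> * of_real y)) = 1"
  by simp_all

lemma norm_fourier_transform_le:
  "norm (fourier_transform f \<xi>) \<le> (\<integral>y. norm (f y) \<partial>lborel)"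
proof -
  have "norm (fourier_transform f \<xi>) \<le> (\<integral>y. norm (exp (- 2 * of_real pi * \<i> * of_real (y \<bullet> \<xi>)) * f y) \<partial>lborel)"
    unfolding fourier_transform_def by (rule integral_norm_bound)
  then show ?thesis
    by (simp only: norm_mult norm_exp_imaginary mult_1)
qed

lemma norm_exp_mult_of_real: "Re w = 1 \<Longrightarrow> norm (exp (- w * of_real r)) = exp (- r)"
  by simp

lemma integrable_exp_fourier_transform:
  fixes f :: "'a::euclidean_space \<Rightarrow> complex"
  assumes w: "Re w = 1" and f: "integrable lborel f"
  shows "integrable lborel (\<lambda>\<xi>. exp (- w * of_real ((norm \<xi>)\<^sup>2)) * fourier_transform f \<xi> * exp (2 * of_real pi * \<i> * of_real (x \<bullet> \<xi>)))"
proof (rule Bochner_Integration.integrable_bound)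
  have [measurable]: "f \<in> borel_measurable borel" using f by auto
  show "integrable lborel (\<lambda>\<xi>::'a. exp (- 1 * (norm \<xi>)\<^sup>2) * (\<integral>y. norm (f y) \<partial>lborel))"
    using integrable_real_gaussian[of 1, where 'a = 'a] by simp
  show "AE \<xi> in lborel. norm (exp (- w * of_real ((norm \<xi>)\<^sup>2)) * fourier_transform f \<xi> * exp (2 * of_real pi * \<i> * of_real (x \<bullet> \<xi>)))
      \<le> norm (exp (- 1 * (norm \<xi>)\<^sup>2) * (\<integral>y. norm (f y) \<partial>lborel))"
  proof (rule AE_I2)
    fix \<xi> :: 'a
    have "exp (- (norm \<xi>)\<^sup>2) * norm (fourier_transform f \<xi>) * 1 \<le> exp (- (norm \<xi>)\<^sup>2) * (\<integral>y. norm (f y) \<partial>lborel) * 1"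
      by (intro mult_right_mono mult_left_mono norm_fourier_transform_le) auto
    then show "norm (exp (- w * of_real ((norm \<xi>)\<^sup>2)) * fourier_transform f \<xi> * exp (2 * of_real pi * \<i> * of_real (x \<bullet> \<xi>)))
      \<le> norm (exp (- 1 * (norm \<xi>)\<^sup>2) * (\<integral>y. norm (f y) \<partial>lborel))"
      unfolding norm_mult norm_exp_imaginary norm_exp_mult_of_real[OF w] by simp
  qed
  show "(\<lambda>\<xi>. exp (- w * of_real ((norm \<xi>)\<^sup>2)) * fourier_transform f \<xi> * exp (2 * of_real pi * \<i> * of_real (x \<bullet> \<xi>))) \<in> borel_measurable lborel"
    by measurable
qed

lemma heat_conv_eq_fourier:
  fixes f :: "'a::euclidean_space \<Rightarrow> complex"
  assumes w: "Re w = 1" and f: "integrable lborel f"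
  shows "(\<integral>\<xi>. exp (- w * of_real ((norm \<xi>)\<^sup>2)) * fourier_transform f \<xi> * exp (2 * of_real pi * \<i> * of_real (x \<bullet> \<xi>)) \<partial>lborel) = heat_conv w f x"
proof -
  have [measurable]: "f \<in> borel_measurable borel" using f by auto
  define \<Phi> where "\<Phi> = (\<lambda>\<xi> y. exp (- w * of_real ((norm \<xi>)\<^sup>2)) * (exp (- 2 * of_real pi * \<i> * of_real (y \<bullet> \<xi>)) * f y) * exp (2 * of_real pi * \<i> * of_real (x \<bullet> \<xi>)))"
  have int: "integrable (lborel \<Otimes>\<^sub>M lborel) (\<lambda>(\<xi>, y). \<Phi> \<xi> y)"
  proof (rule Bochner_Integration.integrable_bound)
    show "integrable (lborel \<Otimes>\<^sub>M lborel) (\<lambda>p::'a \<times> 'a. exp (- 1 * (norm (fst p))\<^sup>2) * norm (f (snd p)))"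
      using f by (intro lborel_pair.integrable_mult_pair[where g = "\<lambda>y. norm (f y)"] integrable_real_gaussian) auto
    show "AE p in lborel \<Otimes>\<^sub>M lborel. norm (case p of (\<xi>, y) \<Rightarrow> \<Phi> \<xi> y) \<le> norm (exp (- 1 * (norm (fst p))\<^sup>2) * norm (f (snd p)))"
      using w by (intro AE_I2) (auto simp: \<Phi>_def norm_mult)
    show "(\<lambda>(\<xi>, y). \<Phi> \<xi> y) \<in> borel_measurable (lborel \<Otimes>\<^sub>M lborel)"
      unfolding \<Phi>_def by measurable
  qed
  have "(\<integral>\<xi>. exp (- w * of_real ((norm \<xi>)\<^sup>2)) * fourier_transform f \<xi> * exp (2 * of_real pi * \<i> * of_real (x \<bullet> \<xi>)) \<partial>lborel)
      = (\<integral>\<xi>. (\<integral>y. \<Phi> \<xi> y \<partial>lborel) \<partial>lborel)"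
    unfolding \<Phi>_def fourier_transform_def by (simp only: integral_mult_left_zero integral_mult_right_zero)
  also have "\<dots> = (\<integral>y. (\<integral>\<xi>. \<Phi> \<xi> y \<partial>lborel) \<partial>lborel)"
    by (rule lborel_pair.Fubini_integral[OF int, symmetric])
  also have "\<dots> = (\<integral>y. heat w (x - y) * f y \<partial>lborel)"
  proof (intro Bochner_Integration.integral_cong refl)
    fix y
    have "exp (- 2 * of_real pi * \<i> * of_real (y \<bullet> \<xi>)) * exp (2 * of_real pi * \<i> * of_real (x \<bullet> \<xi>))
       = exp (2 * of_real pi * \<i> * of_real ((x - y) \<bullet> \<xi>))" for \<xi>
      by (simp add: inner_diff_left algebra_simps flip: exp_add)
    moreover have "\<Phi> \<xi> y = (exp (- w * of_real ((norm \<xi>)\<^sup>2)) * (exp (- 2 * of_real pi * \<i> * of_real (y \<bullet> \<xi>)) * exp (2 * of_real pi * \<i> * of_real (x \<bullet> \<xi>)))) * f y" for \<xi>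
      by (simp only: \<Phi>_def mult_ac)
    ultimately have "\<Phi> \<xi> y = (exp (- w * of_real ((norm \<xi>)\<^sup>2)) * exp (2 * of_real pi * \<i> * of_real ((x - y) \<bullet> \<xi>))) * f y" for \<xi>
      by simp
    then show "(\<integral>\<xi>. \<Phi> \<xi> y \<partial>lborel) = heat w (x - y) * f y"
      using w by (simp add: heat_eq_fourier)
  qed
  finally show ?thesis
    unfolding heat_conv_def .
qed

lemma bilinear_bochner_riesz_eq_heat:
  fixes f g :: "'a::euclidean_space \<Rightarrow> complex"
  assumes \<delta>: "\<delta> > 0" and f: "integrable lborel f" and g: "integrable lborel g"
  shows "bilinear_bochner_riesz \<delta> f g x = of_real (1 / (2 * pi)) *
    (\<integral>t. gamma_fourier \<delta> t * exp (1 + \<i> * of_real t) *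
      (heat_conv (1 + \<i> * of_real t) f x * heat_conv (1 + \<i> * of_real t) g x) \<partial>lborel)"
proof -
  have [measurable]: "f \<in> borel_measurable borel" "g \<in> borel_measurable borel" using f g by auto
  define w where "w = (\<lambda>t::real. 1 + \<i> * of_real t)"
  have [measurable]: "w \<in> borel_measurable borel" unfolding w_def by measurable
  have w: "Re (w t) = 1" for t by (simp add: w_def)
  define e where "e = (\<lambda>\<xi>. exp (2 * of_real pi * \<i> * of_real (x \<bullet> \<xi>)))"
  have [measurable]: "e \<in> borel_measurable borel" unfolding e_def by measurable
  have norm_e: "norm (e \<xi>) = 1" for \<xi> unfolding e_def by (rule norm_exp_imaginary)
  define H where "H = (\<lambda>f t \<xi>. exp (- w t * of_real ((norm \<xi>)\<^sup>2)) * fourier_transform f \<xi> * e \<xi>)"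
  define N where "N = (\<lambda>f::'a \<Rightarrow> complex. \<integral>y. norm (f y) \<partial>lborel)"
  have H_le: "norm (H f t \<xi>) \<le> N f * exp (- 1 * (norm \<xi>)\<^sup>2)" for f t \<xi>
    using norm_fourier_transform_le[of f \<xi>] w[of t]
    by (simp add: H_def norm_mult norm_e N_def mult.commute)
  have N: "N f \<ge> 0" for f by (simp add: N_def)
  define \<Phi> where "\<Phi> = (\<lambda>t z. gamma_fourier \<delta> t * exp (w t) * (H f t (fst z) * H g t (snd z)))"
  have int: "integrable (lborel \<Otimes>\<^sub>M (lborel \<Otimes>\<^sub>M lborel)) (\<lambda>(t, z). \<Phi> t z)"
  proof (rule Bochner_Integration.integrable_bound)
    show "integrable (lborel \<Otimes>\<^sub>M (lborel \<Otimes>\<^sub>M lborel)) (\<lambda>q::real \<times> 'a \<times> 'a. (norm (gamma_fourier \<delta> (fst q)) * exp 1)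
        * ((N f * exp (- 1 * (norm (fst (snd q)))\<^sup>2)) * (N g * exp (- 1 * (norm (snd (snd q)))\<^sup>2))))"
      using integrable_gamma_fourier_transform[OF \<delta>] integrable_real_gaussian[of 1, where 'a = 'a]
      by (intro lborel_triple.integrable_mult_pair[where f = "\<lambda>t. norm (gamma_fourier \<delta> t) * exp 1"]
          lborel_pair.integrable_mult_pair[where f = "\<lambda>\<xi>. N f * exp (- 1 * (norm \<xi>)\<^sup>2)" and g = "\<lambda>\<xi>. N g * exp (- 1 * (norm \<xi>)\<^sup>2)"]) auto
    show "AE q in lborel \<Otimes>\<^sub>M (lborel \<Otimes>\<^sub>M lborel). norm (case q of (t, z) \<Rightarrow> \<Phi> t z) \<le> norm ((norm (gamma_fourier \<delta> (fst q)) * exp 1)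
        * ((N f * exp (- 1 * (norm (fst (snd q)))\<^sup>2)) * (N g * exp (- 1 * (norm (snd (snd q)))\<^sup>2))))"
    proof (rule AE_I2)
      fix q :: "real \<times> 'a \<times> 'a"
      have "norm (case q of (t, z) \<Rightarrow> \<Phi> t z) = (norm (gamma_fourier \<delta> (fst q)) * exp 1)
          * (norm (H f (fst q) (fst (snd q))) * norm (H g (fst q) (snd (snd q))))"
        by (simp add: \<Phi>_def norm_mult w split_beta)
      also have "\<dots> \<le> (norm (gamma_fourier \<delta> (fst q)) * exp 1)
        * ((N f * exp (- 1 * (norm (fst (snd q)))\<^sup>2)) * (N g * exp (- 1 * (norm (snd (snd q)))\<^sup>2)))"
        using N by (intro mult_left_mono mult_mono H_le) auto
      also have "\<dots> \<le> norm \<dots>" by simp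
      finally show "norm (case q of (t, z) \<Rightarrow> \<Phi> t z) \<le> norm ((norm (gamma_fourier \<delta> (fst q)) * exp 1)
        * ((N f * exp (- 1 * (norm (fst (snd q)))\<^sup>2)) * (N g * exp (- 1 * (norm (snd (snd q)))\<^sup>2))))" .
    qed
    show "(\<lambda>(t, z). \<Phi> t z) \<in> borel_measurable (lborel \<Otimes>\<^sub>M (lborel \<Otimes>\<^sub>M lborel))"
      unfolding \<Phi>_def H_def by measurable
  qed
  have inner_t: "(\<integral>t. \<Phi> t z \<partial>lborel) = of_real (2 * pi) *
      (indicat_real {z. (norm (fst z))\<^sup>2 + (norm (snd z))\<^sup>2 \<le> 1} z *\<^sub>R
        (of_real ((1 - (norm (fst z))\<^sup>2 - (norm (snd z))\<^sup>2) powr \<delta>) * fourier_transform f (fst z) * fourier_transform g (snd z)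
        * exp (2 * of_real pi * \<i> * of_real (x \<bullet> (fst z + snd z)))))" for z
  proof -
    define A where "A = 1 - (norm (fst z))\<^sup>2 - (norm (snd z))\<^sup>2"
    define R where "R = fourier_transform f (fst z) * fourier_transform g (snd z) * (e (fst z) * e (snd z))"
    have "exp (w t) * (exp (- w t * of_real ((norm (fst z))\<^sup>2)) * exp (- w t * of_real ((norm (snd z))\<^sup>2)))
        = exp (of_real A) * exp (\<i> * of_real (t * A))" for t
      unfolding exp_add[symmetric] by (simp add: A_def w_def algebra_simps)
    moreover have "\<Phi> t z = gamma_fourier \<delta> t * (exp (w t) * (exp (- w t * of_real ((norm (fst z))\<^sup>2)) * exp (- w t * of_real ((norm (snd z))\<^sup>2)))) * R" for t
      by (simp only: \<Phi>_def H_def R_def mult_ac)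
    ultimately have "\<Phi> t z = (of_real (exp A) * R) * (gamma_fourier \<delta> t * exp (\<i> * of_real (t * A)))" for t
      by (simp only: exp_of_real[symmetric] mult_ac)
    then have "(\<integral>t. \<Phi> t z \<partial>lborel) = of_real (exp A) * R * of_real (2 * pi * gamma_weight \<delta> A)"
      by (simp only: integral_mult_right_zero gamma_fourier_inversion[OF \<delta>])
    also have "\<dots> = of_real (2 * pi) * (of_real (max 0 A powr \<delta>) * R)"
      by (simp add: gamma_weight_def exp_minus flip: exp_of_real)
    also have "of_real (max 0 A powr \<delta>) * R = indicat_real {z. (norm (fst z))\<^sup>2 + (norm (snd z))\<^sup>2 \<le> 1} z *\<^sub>R (of_real (A powr \<delta>) * R)"
      by (auto simp: A_def max_def split: split_indicator)
    finally have *: "(\<integral>t. \<Phi> t z \<partial>lborel) = of_real (2 * pi) *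
      (indicat_real {z. (norm (fst z))\<^sup>2 + (norm (snd z))\<^sup>2 \<le> 1} z *\<^sub>R (of_real (A powr \<delta>) * R))" .
    have "e (fst z) * e (snd z) = exp (2 * of_real pi * \<i> * of_real (x \<bullet> (fst z + snd z)))"
      by (simp add: e_def inner_add_right algebra_simps flip: exp_add)
    with * show ?thesis
      by (simp only: R_def A_def mult.assoc)
  qed
  have inner_z: "(\<integral>z. \<Phi> t z \<partial>(lborel \<Otimes>\<^sub>M lborel)) = gamma_fourier \<delta> t * exp (w t) * (heat_conv (w t) f x * heat_conv (w t) g x)" for t
  proof -
    have "(\<integral>z. H f t (fst z) * H g t (snd z) \<partial>(lborel \<Otimes>\<^sub>M lborel)) = heat_conv (w t) f x * heat_conv (w t) g x"
      using lborel_pair.integral_mult_pair[of "H f t" "H g t"]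
        integrable_exp_fourier_transform[OF w f, of t x] integrable_exp_fourier_transform[OF w g, of t x]
        heat_conv_eq_fourier[OF w f, of t x] heat_conv_eq_fourier[OF w g, of t x]
      by (simp add: H_def e_def)
    then show ?thesis
      unfolding \<Phi>_def integral_mult_right_zero by simp
  qed
  have "of_real (2 * pi) * bilinear_bochner_riesz \<delta> f g x = (\<integral>z. (\<integral>t. \<Phi> t z \<partial>lborel) \<partial>(lborel \<Otimes>\<^sub>M lborel))"
    unfolding inner_t integral_mult_right_zero bilinear_bochner_riesz_def set_lebesgue_integral_def lborel_prod ..
  also have "\<dots> = (\<integral>t. (\<integral>z. \<Phi> t z \<partial>(lborel \<Otimes>\<^sub>M lborel)) \<partial>lborel)"
    by (rule lborel_triple.Fubini_integral[OF int])
  finally show ?thesis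
    unfolding inner_z w_def by (simp add: field_simps)
qed

lemma heat_conv_shift:
  fixes g :: "'a::euclidean_space \<Rightarrow> complex"
  assumes [measurable]: "g \<in> borel_measurable borel"
  shows "heat_conv w g (x + y) = heat_conv w (\<lambda>z. g (z + y)) x"
  using integral_lborel_shift[of "\<lambda>z. heat w (x + y - z) * g z" y] by (simp add: heat_conv_def)

lemma AE_lborel_shift:
  fixes P :: "'a::euclidean_space \<Rightarrow> bool"
  assumes "AE x in lborel. P x" and [measurable]: "Measurable.pred borel P"
  shows "AE x in lborel. P (x + y)"
proof -
  have "AE x in distr lborel borel ((+) y). P x"
    using assms(1) by (simp only: lborel_distr_plus)
  then show ?thesis
    by (subst (asm) AE_distr_iff) (auto simp: add.commute)
qed

lemma heat_conv_mult_heat_conv_le: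
  fixes f g :: "'a::euclidean_space \<Rightarrow> complex"
  assumes w: "Re w = 1" and f: "integrable lborel f" and g: "integrable lborel g"
    and G: "AE x in lborel. norm (g x) \<le> G" and G0: "G > 0"
  shows "(\<integral>\<^sup>+x. ennreal (norm (heat_conv w f x * heat_conv w g x)) \<partial>lborel)
    \<le> (\<integral>\<^sup>+x. ennreal (norm (f x)) \<partial>lborel) * ennreal (sqrt (pi * norm w) ^ DIM('a) * G)"
proof -
  have [measurable]: "f \<in> borel_measurable borel" "g \<in> borel_measurable borel" using f g by auto
  have "(\<integral>\<^sup>+x. ennreal (norm (heat_conv w f x * heat_conv w g x)) \<partial>lborel)
    \<le> (\<integral>\<^sup>+x. (\<integral>\<^sup>+y. ennreal (norm (f y)) * ennreal (norm (heat w (x - y)) * norm (heat_conv w g x)) \<partial>lborel) \<partial>lborel)"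
  proof (intro nn_integral_mono)
    fix x :: 'a
    have "ennreal (norm (heat_conv w f x)) \<le> (\<integral>\<^sup>+y. ennreal (norm (heat w (x - y) * f y)) \<partial>lborel)"
      unfolding heat_conv_def by (intro integral_norm_bound_ennreal integrable_heat_mult w f)
    then have "ennreal (norm (heat_conv w f x)) * ennreal (norm (heat_conv w g x))
        \<le> (\<integral>\<^sup>+y. ennreal (norm (heat w (x - y) * f y)) \<partial>lborel) * ennreal (norm (heat_conv w g x))"
      by (rule mult_right_mono) simp
    also have "\<dots> = (\<integral>\<^sup>+y. ennreal (norm (heat w (x - y) * f y)) * ennreal (norm (heat_conv w g x)) \<partial>lborel)"
      by (rule nn_integral_multc[symmetric]) measurable
    finally show "ennreal (norm (heat_conv w f x * heat_conv w g x))
        \<le> (\<integral>\<^sup>+y. ennreal (norm (f y)) * ennreal (norm (heat w (x - y)) * norm (heat_conv w g x)) \<partial>lborel)"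
      by (simp add: norm_mult ennreal_mult mult_ac)
  qed
  also have "\<dots> = (\<integral>\<^sup>+y. (\<integral>\<^sup>+x. ennreal (norm (f y)) * ennreal (norm (heat w (x - y)) * norm (heat_conv w g x)) \<partial>lborel) \<partial>lborel)"
    by (rule lborel_pair.Fubini') measurable
  also have "\<dots> \<le> (\<integral>\<^sup>+y. ennreal (norm (f y)) * ennreal (sqrt (pi * norm w) ^ DIM('a) * G) \<partial>lborel)"
  proof (intro nn_integral_mono)
    fix y :: 'a
    have "(\<integral>\<^sup>+x. ennreal (norm (heat w (x - y)) * norm (heat_conv w g x)) \<partial>lborel)
        = (\<integral>\<^sup>+x. ennreal (norm (heat w (x + y - y)) * norm (heat_conv w g (x + y))) \<partial>lborel)"
      by (rule nn_integral_lborel_shift[symmetric]) measurable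
    also have "\<dots> = (\<integral>\<^sup>+x. ennreal (norm (heat w x) * norm (heat_conv w (\<lambda>z. g (z + y)) x)) \<partial>lborel)"
      by (simp add: heat_conv_shift)
    also have "\<dots> \<le> ennreal (sqrt (pi * norm w) ^ DIM('a) * G)"
      using g G by (intro heat_mult_heat_conv_le w G0 AE_lborel_shift) (auto simp: integrable_lborel_shift)
    finally have "(\<integral>\<^sup>+x. ennreal (norm (heat w (x - y)) * norm (heat_conv w g x)) \<partial>lborel) \<le> ennreal (sqrt (pi * norm w) ^ DIM('a) * G)" .
    then show "(\<integral>\<^sup>+x. ennreal (norm (f y)) * ennreal (norm (heat w (x - y)) * norm (heat_conv w g x)) \<partial>lborel)
        \<le> ennreal (norm (f y)) * ennreal (sqrt (pi * norm w) ^ DIM('a) * G)"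
      by (subst nn_integral_cmult) (auto intro: mult_left_mono)
  qed
  also have "\<dots> = (\<integral>\<^sup>+x. ennreal (norm (f x)) \<partial>lborel) * ennreal (sqrt (pi * norm w) ^ DIM('a) * G)"
    by (rule nn_integral_multc) measurable
  finally show ?thesis .
qed

lemma borel_measurable_bilinear_bochner_riesz:
  assumes \<delta>: "\<delta> > 0" and f: "integrable lborel f" and g: "integrable lborel g"
  shows "bilinear_bochner_riesz \<delta> f g \<in> borel_measurable borel"
proof -
  have [measurable]: "f \<in> borel_measurable borel" "g \<in> borel_measurable borel" using f g by auto
  show ?thesis
    unfolding bilinear_bochner_riesz_eq_heat[OF \<delta> f g, abs_def] by measurable
qed

definition bochner_riesz_const :: "nat \<Rightarrow> real \<Rightarrow> real" where
  "bochner_riesz_const n \<delta> = exp 1 * (\<integral>t. norm (gamma_fourier \<delta> t) * sqrt (pi * sqrt (1 + t\<^sup>2)) ^ n \<partial>lborel)"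

lemma bochner_riesz_const_nonneg: "bochner_riesz_const n \<delta> \<ge> 0"
  by (auto simp: bochner_riesz_const_def intro!: mult_nonneg_nonneg integral_nonneg_AE)

lemma bochner_riesz_const_integrable:
  assumes "\<delta> > real n / 2"
  shows "integrable lborel (\<lambda>t. norm (gamma_fourier \<delta> t) * sqrt (pi * sqrt (1 + t\<^sup>2)) ^ n)"
proof -
  have eq: "norm (gamma_fourier \<delta> t) * sqrt (pi * sqrt (1 + t\<^sup>2)) ^ n
      = sqrt pi ^ n * (norm (gamma_fourier \<delta> t) * sqrt (1 + t\<^sup>2) powr (real n / 2))" for t
  proof -
    define s where "s = sqrt (1 + t\<^sup>2)"
    have s: "s > 0" by (simp add: s_def add_pos_nonneg)
    have "s powr (real n / 2) = (s powr (1 / 2)) powr real n"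
      by (simp add: powr_powr)
    also have "\<dots> = sqrt s ^ n"
      using s by (simp add: powr_half_sqrt powr_realpow)
    finally show ?thesis
      unfolding s_def[symmetric] by (simp add: real_sqrt_mult power_mult_distrib)
  qed
  have "\<delta> > 0"
    using assms by (meson divide_nonneg_nonneg le_less_trans of_nat_0_le_iff zero_le_numeral)
  then show ?thesis
    unfolding eq using assms by (intro integrable_mult_right integrable_gamma_fourier_powr)
qed

lemma bilinear_bochner_riesz_L1_le:
  fixes f g :: "'a::euclidean_space \<Rightarrow> complex"
  assumes \<delta>: "\<delta> > real DIM('a) / 2" and f: "integrable lborel f" and g: "integrable lborel g"
    and G: "AE x in lborel. norm (g x) \<le> G" and G0: "G > 0"
  shows "(\<integral>\<^sup>+x. ennreal (norm (bilinear_bochner_riesz \<delta> f g x)) \<partial>lborel)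
    \<le> ennreal (bochner_riesz_const DIM('a) \<delta>) * (\<integral>\<^sup>+x. ennreal (norm (f x)) \<partial>lborel) * ennreal G"
proof -
  have [measurable]: "f \<in> borel_measurable borel" "g \<in> borel_measurable borel" using f g by auto
  have \<delta>0: "\<delta> > 0"
    using \<delta> by (meson divide_nonneg_nonneg le_less_trans of_nat_0_le_iff zero_le_numeral)
  define F where "F = (\<integral>\<^sup>+x. ennreal (norm (f x)) \<partial>lborel)"
  define w where "w = (\<lambda>t::real. 1 + \<i> * of_real t)"
  have [measurable]: "w \<in> borel_measurable borel" unfolding w_def by measurable
  have w: "Re (w t) = 1" "norm (w t) = sqrt (1 + t\<^sup>2)" for t
    by (simp_all add: w_def cmod_def)
  define k where "k = (\<lambda>t. norm (gamma_fourier \<delta> t) * sqrt (pi * sqrt (1 + t\<^sup>2)) ^ DIM('a))"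
  define \<Psi> where "\<Psi> = (\<lambda>t x. gamma_fourier \<delta> t * exp (w t) * (heat_conv (w t) f x * heat_conv (w t) g x))"
  have [measurable]: "(\<lambda>(t, x). \<Psi> t x) \<in> borel_measurable (borel \<Otimes>\<^sub>M borel)"
    unfolding \<Psi>_def by measurable
  have "norm (bilinear_bochner_riesz \<delta> f g x) \<le> norm (\<integral>t. \<Psi> t x \<partial>lborel)" for x
  proof -
    have "norm (bilinear_bochner_riesz \<delta> f g x) = 1 / (2 * pi) * norm (\<integral>t. \<Psi> t x \<partial>lborel)"
      unfolding bilinear_bochner_riesz_eq_heat[OF \<delta>0 f g] \<Psi>_def w_def norm_mult norm_of_real by simp
    also have "\<dots> \<le> 1 * norm (\<integral>t. \<Psi> t x \<partial>lborel)"
      using pi_gt3 by (intro mult_right_mono) (auto simp: divide_simps)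
    finally show ?thesis by simp
  qed
  then have "(\<integral>\<^sup>+x. ennreal (norm (bilinear_bochner_riesz \<delta> f g x)) \<partial>lborel)
    \<le> (\<integral>\<^sup>+x. ennreal (norm (\<integral>t. \<Psi> t x \<partial>lborel)) \<partial>lborel)"
    by (intro nn_integral_mono ennreal_leI)
  also have "\<dots> \<le> (\<integral>\<^sup>+x. (\<integral>\<^sup>+t. ennreal (norm (\<Psi> t x)) \<partial>lborel) \<partial>lborel)"
  proof (intro nn_integral_mono)
    show "ennreal (norm (\<integral>t. \<Psi> t x \<partial>lborel)) \<le> (\<integral>\<^sup>+t. ennreal (norm (\<Psi> t x)) \<partial>lborel)" for x
      by (cases "integrable lborel (\<lambda>t. \<Psi> t x)") (auto simp: integral_norm_bound_ennreal not_integrable_integral_eq)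
  qed
  also have "\<dots> = (\<integral>\<^sup>+t. (\<integral>\<^sup>+x. ennreal (norm (\<Psi> t x)) \<partial>lborel) \<partial>lborel)"
    by (rule lborel_pair.Fubini'[symmetric]) measurable
  also have "\<dots> \<le> (\<integral>\<^sup>+t. ennreal (k t) * (ennreal (exp 1) * F * ennreal G) \<partial>lborel)"
  proof (intro nn_integral_mono)
    fix t
    have "(\<integral>\<^sup>+x. ennreal (norm (\<Psi> t x)) \<partial>lborel) = (\<integral>\<^sup>+x. ennreal (norm (gamma_fourier \<delta> t) * exp 1) * ennreal (norm (heat_conv (w t) f x * heat_conv (w t) g x)) \<partial>lborel)"
      by (simp add: \<Psi>_def norm_mult w mult.assoc flip: ennreal_mult)
    also have "\<dots> = ennreal (norm (gamma_fourier \<delta> t) * exp 1) * (\<integral>\<^sup>+x. ennreal (norm (heat_conv (w t) f x * heat_conv (w t) g x)) \<partial>lborel)"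
      by (rule nn_integral_cmult) measurable
    also have "\<dots> \<le> ennreal (norm (gamma_fourier \<delta> t) * exp 1) * (F * ennreal (sqrt (pi * norm (w t)) ^ DIM('a) * G))"
      unfolding F_def by (intro mult_left_mono heat_conv_mult_heat_conv_le w f g G G0) auto
    also have "\<dots> = ennreal (k t) * (ennreal (exp 1) * F * ennreal G)"
      using G0 by (simp add: k_def w(2) ennreal_mult mult_ac)
    finally show "(\<integral>\<^sup>+x. ennreal (norm (\<Psi> t x)) \<partial>lborel) \<le> ennreal (k t) * (ennreal (exp 1) * F * ennreal G)" .
  qed
  also have "\<dots> = (\<integral>\<^sup>+t. ennreal (k t) \<partial>lborel) * (ennreal (exp 1) * F * ennreal G)"
    unfolding k_def by (rule nn_integral_multc) measurable
  also have "(\<integral>\<^sup>+t. ennreal (k t) \<partial>lborel) = ennreal (\<integral>t. k t \<partial>lborel)"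
    using bochner_riesz_const_integrable[OF \<delta>] unfolding k_def by (intro nn_integral_eq_integral) auto
  also have "ennreal (\<integral>t. k t \<partial>lborel) * (ennreal (exp 1) * F * ennreal G) = ennreal (bochner_riesz_const DIM('a) \<delta>) * F * ennreal G"
  proof -
    have "(\<integral>t. k t \<partial>lborel) \<ge> 0"
      by (intro integral_nonneg_AE) (auto simp: k_def)
    then show ?thesis
      unfolding bochner_riesz_const_def k_def[symmetric] by (simp add: ennreal_mult mult_ac)
  qed
  finally show ?thesis
    unfolding F_def .
qed

lemma Lp_norm_1: "Lp_norm 1 f = (\<integral>\<^sup>+x. ennreal (norm (f x)) \<partial>lborel)"
  by (auto simp: Lp_norm_def Let_def less_top[symmetric])

lemma Lp_norm_infinity: "Lp_norm \<infinity> f = esssup lborel (\<lambda>x. ennreal (norm (f x)))"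
  by (simp add: Lp_norm_def)

lemma bilinear_bochner_riesz_bound:
  assumes \<delta>: "\<delta> > real DIM('a::euclidean_space) / 2"
  shows "bilinear_Lp_bound (bilinear_bochner_riesz \<delta> :: ('a \<Rightarrow> complex) \<Rightarrow> ('a \<Rightarrow> complex) \<Rightarrow> 'a \<Rightarrow> complex)
    1 \<infinity> 1 (ennreal (bochner_riesz_const DIM('a) \<delta>))"
  unfolding bilinear_Lp_bound_def
proof (intro allI impI conjI)
  fix f g :: "'a \<Rightarrow> complex"
  assume f: "schwartz f" and g: "schwartz g"
  note fi = schwartz_integrable[OF f] and gi = schwartz_integrable[OF g]
  have \<delta>0: "\<delta> > 0"
    using \<delta> by (meson divide_nonneg_nonneg le_less_trans of_nat_0_le_iff zero_le_numeral)
  show "bilinear_bochner_riesz \<delta> f g \<in> borel_measurable lborel"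
    using borel_measurable_bilinear_bochner_riesz[OF \<delta>0 fi gi] by simp
  define c where "c = bochner_riesz_const DIM('a) \<delta>"
  have c: "c \<ge> 0" by (simp add: c_def bochner_riesz_const_nonneg)
  define N where "N = (\<integral>x. norm (f x) \<partial>lborel)"
  have N: "Lp_norm 1 f = ennreal N" "N \<ge> 0"
    using fi unfolding Lp_norm_1 N_def by (auto intro: nn_integral_eq_integral)
  obtain B where B: "\<And>x. norm x ^ 0 * norm (g x) \<le> B"
    using schwartz_decay[OF g] by blast
  have [measurable]: "g \<in> borel_measurable borel" using gi by auto
  have "Lp_norm \<infinity> g \<le> ennreal B"
    unfolding Lp_norm_infinity using B by (intro esssup_I AE_I2 ennreal_leI) auto
  then obtain r where r: "Lp_norm \<infinity> g = ennreal r" "r \<ge> 0"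
    by (metis ennreal_cases ennreal_neq_top top_unique)
  have gr: "AE x in lborel. norm (g x) \<le> r"
    using esssup_AE[of "\<lambda>x. ennreal (norm (g x))" lborel] r(2)
    unfolding r(1)[unfolded Lp_norm_infinity] by simp
  have "Lp_norm 1 (bilinear_bochner_riesz \<delta> f g) \<le> ennreal (c * N * r) + ennreal e" if "e > 0" for e
  proof -
    define \<eta> where "\<eta> = e / (c * N + 1)"
    have cN: "c * N + 1 > 0" using c N by (simp add: add_nonneg_pos)
    then have \<eta>: "\<eta> > 0" using that by (simp add: \<eta>_def)
    have "c * N * \<eta> \<le> (c * N + 1) * \<eta>" using \<eta> by (intro mult_right_mono) auto
    also have "\<dots> = e" using cN by (simp add: \<eta>_def)
    finally have le: "c * N * (r + \<eta>) \<le> c * N * r + e" by (simp add: algebra_simps)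
    have g\<eta>: "AE x in lborel. norm (g x) \<le> r + \<eta>"
      using gr by eventually_elim (use \<eta> in simp)
    have "Lp_norm 1 (bilinear_bochner_riesz \<delta> f g) \<le> ennreal c * ennreal N * ennreal (r + \<eta>)"
      using bilinear_bochner_riesz_L1_le[OF \<delta> fi gi g\<eta>] \<eta> r(2)
      unfolding Lp_norm_1 N(1)[unfolded Lp_norm_1] c_def by simp
    also have "\<dots> = ennreal (c * N * (r + \<eta>))"
      using c N r \<eta> by (simp add: ennreal_mult)
    also have "\<dots> \<le> ennreal (c * N * r + e)"
      using le by (rule ennreal_leI)
    also have "\<dots> = ennreal (c * N * r) + ennreal e"
      using c N r that by simp
    finally show ?thesis .
  qed
  then have "Lp_norm 1 (bilinear_bochner_riesz \<delta> f g) \<le> ennreal (c * N * r)"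
    by (rule ennreal_le_epsilon)
  then show "Lp_norm 1 (bilinear_bochner_riesz \<delta> f g) \<le> ennreal (bochner_riesz_const DIM('a) \<delta>) * Lp_norm 1 f * Lp_norm \<infinity> g"
    unfolding N r c_def[symmetric] using c N r by (simp add: ennreal_mult)
qed

theorem theorem4p9:
  fixes \<delta> :: real
  assumes "CARD('n::finite) \<ge> 2"
    and "\<delta> > real CARD('n) / 2"
  shows "bilinear_Lp_bounded
           (bilinear_bochner_riesz \<delta> ::
              (real ^ 'n \<Rightarrow> complex) \<Rightarrow> (real ^ 'n \<Rightarrow> complex) \<Rightarrow> real ^ 'n \<Rightarrow> complex) 1 \<infinity> 1
       \<and> (\<exists>C::real. C \<ge> 0 \<and>
           bilinear_Lp_opnorm
             (bilinear_bochner_riesz \<delta> ::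
                (real ^ 'n \<Rightarrow> complex) \<Rightarrow> (real ^ 'n \<Rightarrow> complex) \<Rightarrow> real ^ 'n \<Rightarrow> complex) 1 \<infinity> 1
           \<le> ennreal C)"
proof -
  have "bilinear_Lp_bound
           (bilinear_bochner_riesz \<delta> ::
              (real ^ 'n \<Rightarrow> complex) \<Rightarrow> (real ^ 'n \<Rightarrow> complex) \<Rightarrow> real ^ 'n \<Rightarrow> complex) 1 \<infinity> 1
         (ennreal (bochner_riesz_const CARD('n) \<delta>))"
    using bilinear_bochner_riesz_bound[where 'a = "real ^ 'n", of \<delta>] assms(2) by simp
  then show ?thesis
    unfolding bilinear_Lp_bounded_def bilinear_Lp_opnorm_def
    using bochner_riesz_const_nonneg by (blast intro: Inf_lower)
qed

end
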